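(* Let $\Delta$ be a $(d-1)$-dimensional balanced simplicial complex with vertex partition $V=V_1\sqcup\dots\sqcup V_d$ into color classes, and let $n_i:=|V_i|$. Let $K_{n_1,\ldots,n_d}$ be the complete $d$-partite graph on the vertex set $V$ with parts $V_1,\dots,V_d$, and let $\Delta(K_{n_1,\ldots,n_d})$ be its clique complex. Then $$\beta_{i,i+j}\left(\mathbb{F}[\Delta]\right)\leq \beta_{i,i+j}\left(\mathbb{F}\left[\mathrm{Skel}_{j-1}\left(\Delta(K_{n_1,\ldots,n_d})\right)\right]\right)$$ for every $i,j\geq 0$.
   Context: $\mathbb{F}$ is a field. For a simplicial complex $\Gamma$ on vertex set $[n]$, $\mathbb{F}[\Gamma]=S/I_\Gamma$ is its Stanley–Reisner ring, where $S=\mathbb{F}[x_1,\dots,x_n]$ (standard grading) and $I_\Gamma$ is generated by the monomials $\prod_{i\in F}x_i$ for $F\notin\Gamma$; $\beta_{i,i+j}(\mathbb{F}[\Gamma])=\dim_{\mathbb{F}}\mathrm{Tor}_i^S(\mathbb{F}[\Gamma],\mathbb{F})_{i+j}$ are its graded Betti numbers. A $(d-1)$-dimensional simplicial complex is balanced if its vertex set admits a partition $V_1\sqcup\dots\sqcup V_d$ (the color classes, considered part of the data) such that every face meets each $V_i$ in at most one vertex. The clique complex $\Delta(G)$ of a graph $G$ is the simplicial complex whose faces are the vertex sets of cliques of $G$. $\mathrm{Skel}_{k}(\Gamma)$ denotes the set of faces of $\Gamma$ of dimension at most $k$ (so $\mathrm{Skel}_{-1}(\Gamma)=\{\emptyset\}$).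 *)

theory Defs
  imports
    "HOL-Library.Poly_Mapping"
    "HOL-Library.Function_Algebras"
    "HOL-Library.Disjoint_Sets"
    Complex_Main
begin

section \<open>Simplicial complexes\<close>

text \<open>Elements of \<open>V\<close> need not be faces: \<open>Skel\<^sub>-\<^sub>1\<close> is a complex on \<open>V\<close> as well.
  The void complex is excluded, so \<open>{}\<close> is always a face (of dimension \<open>-1\<close>).\<close>

definition simplicial_complex :: "'v set \<Rightarrow> 'v set set \<Rightarrow> bool" where
  "simplicial_complex V \<Gamma> \<longleftrightarrow>
     finite V \<and> \<Gamma> \<subseteq> Pow V \<and> {} \<in> \<Gamma> \<and> (\<forall>F\<in>\<Gamma>. \<forall>G. G \<subseteq> F \<longrightarrow> G \<in> \<Gamma>)"

definition face_dim :: "'v set \<Rightarrow> int" where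
  "face_dim F = int (card F) - 1"

definition complex_dim :: "'v set set \<Rightarrow> int" where
  "complex_dim \<Gamma> = Max (face_dim ` \<Gamma>)"

definition skel :: "int \<Rightarrow> 'v set set \<Rightarrow> 'v set set" where
  "skel k \<Gamma> = {F \<in> \<Gamma>. face_dim F \<le> k}"

definition color_partition :: "nat \<Rightarrow> 'v set \<Rightarrow> (nat \<Rightarrow> 'v set) \<Rightarrow> bool" where
  "color_partition d V C \<longleftrightarrow> V = (\<Union>i\<in>{1..d}. C i) \<and> disjoint_family_on C {1..d}"

definition balanced_complex ::
    "nat \<Rightarrow> 'v set \<Rightarrow> (nat \<Rightarrow> 'v set) \<Rightarrow> 'v set set \<Rightarrow> bool" where
  "balanced_complex d V C \<Delta> \<longleftrightarrow>
     simplicial_complex V \<Delta> \<and> complex_dim \<Delta> = int d - 1 \<and> color_partition d V C \<and>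
     (\<forall>F\<in>\<Delta>. \<forall>i\<in>{1..d}. card (F \<inter> C i) \<le> 1)"

definition complete_multipartite_edges :: "nat \<Rightarrow> (nat \<Rightarrow> 'v set) \<Rightarrow> 'v set set" where
  "complete_multipartite_edges d C =
     {{u, v} | u v. \<exists>i\<in>{1..d}. \<exists>j\<in>{1..d}. i \<noteq> j \<and> u \<in> C i \<and> v \<in> C j}"

definition clique_complex :: "'v set \<Rightarrow> 'v set set \<Rightarrow> 'v set set" where
  "clique_complex V E = {W. W \<subseteq> V \<and> (\<forall>u\<in>W. \<forall>v\<in>W. u \<noteq> v \<longrightarrow> {u, v} \<in> E)}"


section \<open>Polynomial rings and Stanley--Reisner ideals\<close>

type_synonym ('v, 'k) mpoly = "('v \<Rightarrow>\<^sub>0 nat) \<Rightarrow>\<^sub>0 'k"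

text \<open>The ring \<open>S = \<F>[x\<^sub>v | v \<in> V]\<close> is carved out of the polynomials in variables indexed by
  the whole type.\<close>

definition poly_ring :: "'v set \<Rightarrow> ('v, 'k::field) mpoly set" where
  "poly_ring V = {p. \<forall>m \<in> Poly_Mapping.keys p. Poly_Mapping.keys m \<subseteq> V}"

definition var :: "'v \<Rightarrow> ('v, 'k::field) mpoly" where
  "var v = Poly_Mapping.single (Poly_Mapping.single v 1) 1"

definition const :: "'k::field \<Rightarrow> ('v, 'k) mpoly" where
  "const c = Poly_Mapping.single 0 c"

definition mono_deg :: "('v \<Rightarrow>\<^sub>0 nat) \<Rightarrow> nat" where
  "mono_deg m = (\<Sum>v \<in> Poly_Mapping.keys m. Poly_Mapping.lookup m v)"

definition ideal_gen :: "'v set \<Rightarrow> ('v, 'k::field) mpoly set \<Rightarrow> ('v, 'k) mpoly set" where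
  "ideal_gen V G =
     {(\<Sum>g\<in>A. c g * g) | A c. finite A \<and> A \<subseteq> G \<and> (\<forall>g\<in>A. c g \<in> poly_ring V)}"

definition sr_ideal :: "'v set \<Rightarrow> 'v set set \<Rightarrow> ('v, 'k::field) mpoly set" where
  "sr_ideal V \<Gamma> = ideal_gen V {(\<Prod>v\<in>F. var v) | F. F \<subseteq> V \<and> F \<notin> \<Gamma>}"

text \<open>The residue field \<open>\<F>\<close>, as an \<open>S\<close>-module, is \<open>S\<close> modulo this ideal.\<close>

definition irrelevant_ideal :: "'v set \<Rightarrow> ('v, 'k::field) mpoly set" where
  "irrelevant_ideal V = ideal_gen V (var ` V)"


section \<open>Graded free resolutions and Tor\<close>

text \<open>
  A complex of finitely generated graded free \<open>S\<close>-modules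
  \<open>P\<^sub>i = \<Oplus>\<^sub>k S(-sh i k)\<close>, \<open>k < rk i\<close>. The matrix \<open>mat i\<close> describes the map
  \<open>P\<^sub>i\<^sub>+\<^sub>1 \<rightarrow> P\<^sub>i\<close>: the image of the \<open>k\<close>-th basis element has \<open>l\<close>-th coordinate \<open>mat i k l\<close>.
  The entries \<open>aug k\<close> describe the augmentation \<open>P\<^sub>0 \<rightarrow> S/J\<close>.
\<close>

record (overloaded) ('v, 'k) free_cplx =
  rk :: "nat \<Rightarrow> nat"
  sh :: "nat \<Rightarrow> nat \<Rightarrow> nat"
  mat :: "nat \<Rightarrow> nat \<Rightarrow> nat \<Rightarrow> ('v, 'k) mpoly"
  aug :: "nat \<Rightarrow> ('v, 'k) mpoly"

definition free_mod :: "'v set \<Rightarrow> nat \<Rightarrow> (nat \<Rightarrow> ('v, 'k::field) mpoly) set" where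
  "free_mod V r = {x. (\<forall>k<r. x k \<in> poly_ring V) \<and> (\<forall>k\<ge>r. x k = 0)}"

definition graded_part ::
    "'v set \<Rightarrow> ('v, 'k::field) free_cplx \<Rightarrow> nat \<Rightarrow> nat \<Rightarrow> (nat \<Rightarrow> ('v, 'k) mpoly) set" where
  "graded_part V P i e =
     {x \<in> free_mod V (rk P i).
        \<forall>k < rk P i. \<forall>m \<in> Poly_Mapping.keys (x k). mono_deg m + sh P i k = e}"

definition diff_map ::
    "('v, 'k::field) free_cplx \<Rightarrow> nat \<Rightarrow> (nat \<Rightarrow> ('v, 'k) mpoly) \<Rightarrow> (nat \<Rightarrow> ('v, 'k) mpoly)" where
  "diff_map P i x = (\<lambda>l. if l < rk P i then (\<Sum>k < rk P (Suc i). x k * mat P i k l) else 0)"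

definition aug_map :: "('v, 'k::field) free_cplx \<Rightarrow> (nat \<Rightarrow> ('v, 'k) mpoly) \<Rightarrow> ('v, 'k) mpoly" where
  "aug_map P x = (\<Sum>k < rk P 0. x k * aug P k)"

text \<open>\<open>\<cdots> \<rightarrow> P\<^sub>1 \<rightarrow> P\<^sub>0 \<rightarrow> S/J \<rightarrow> 0\<close> is exact, with all maps \<open>S\<close>-linear of degree \<open>0\<close>.\<close>

definition graded_free_resolution ::
    "'v set \<Rightarrow> ('v, 'k::field) mpoly set \<Rightarrow> ('v, 'k) free_cplx \<Rightarrow> bool" where
  "graded_free_resolution V J P \<longleftrightarrow>
     (\<forall>i. \<forall>k < rk P (Suc i). \<forall>l < rk P i. mat P i k l \<in> poly_ring V \<and>
        (\<forall>m \<in> Poly_Mapping.keys (mat P i k l). mono_deg m + sh P i l = sh P (Suc i) k)) \<and>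
     (\<forall>k < rk P 0. aug P k \<in> poly_ring V \<and>
        (\<forall>m \<in> Poly_Mapping.keys (aug P k). mono_deg m = sh P 0 k)) \<and>
     (\<forall>s \<in> poly_ring V. \<exists>x \<in> free_mod V (rk P 0). s - aug_map P x \<in> J) \<and>
     {x \<in> free_mod V (rk P 0). aug_map P x \<in> J} = diff_map P 0 ` free_mod V (rk P 1) \<and>
     (\<forall>i. {x \<in> free_mod V (rk P (Suc i)). diff_map P i x = 0}
            = diff_map P (Suc i) ` free_mod V (rk P (Suc (Suc i))))"

text \<open>
  \<open>Tor\<^sub>i(S/I, S/J)\<close> is the \<open>i\<close>-th homology of \<open>S/I \<otimes> P = P/IP\<close> for a graded free resolution \<open>P\<close>
  of \<open>S/J\<close>. The next two sets are the preimages in \<open>(P\<^sub>i)\<^sub>e\<close> of the cycles and the boundaries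
  of \<open>P/IP\<close> in homological degree \<open>i\<close> and internal degree \<open>e\<close>.
\<close>

definition tor_cycles ::
    "'v set \<Rightarrow> ('v, 'k::field) mpoly set \<Rightarrow> ('v, 'k) free_cplx \<Rightarrow> nat \<Rightarrow> nat
       \<Rightarrow> (nat \<Rightarrow> ('v, 'k) mpoly) set" where
  "tor_cycles V I P i e =
     {x \<in> graded_part V P i e. \<forall>i'. i = Suc i' \<longrightarrow> (\<forall>l < rk P i'. diff_map P i' x l \<in> I)}"

definition tor_boundaries ::
    "'v set \<Rightarrow> ('v, 'k::field) mpoly set \<Rightarrow> ('v, 'k) free_cplx \<Rightarrow> nat \<Rightarrow> nat
       \<Rightarrow> (nat \<Rightarrow> ('v, 'k) mpoly) set" where
  "tor_boundaries V I P i e =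
     {x \<in> graded_part V P i e.
        \<exists>y \<in> graded_part V P (Suc i) e. \<forall>k < rk P i. x k - diff_map P i y k \<in> I}"

abbreviation vec_dim :: "(nat \<Rightarrow> ('v, 'k::field) mpoly) set \<Rightarrow> nat" where
  "vec_dim \<equiv> vector_space.dim (\<lambda>(c::'k) x k. const c * x k)"

text \<open>
  \<open>dim\<^sub>\<F> Tor\<^sub>i(S/I, S/J)\<^sub>e\<close>. For finite \<open>V\<close> the graded pieces of a finitely generated module are
  finite-dimensional and the boundaries form a subspace of the cycles, so the difference is the
  dimension of the quotient. The resolution is arbitrary; the dimension does not depend
  on it.
\<close>

definition tor_dim ::
    "'v set \<Rightarrow> ('v, 'k::field) mpoly set \<Rightarrow> ('v, 'k) mpoly set \<Rightarrow> nat \<Rightarrow> nat \<Rightarrow> nat" where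
  "tor_dim V I J i e =
     (let P = (SOME P. graded_free_resolution V J P)
      in vec_dim (tor_cycles V I P i e) - vec_dim (tor_boundaries V I P i e))"

text \<open>\<open>betti TYPE('k) V \<Gamma> i e\<close> is \<open>\<beta>\<^sub>i\<^sub>,\<^sub>e(\<F>[\<Gamma>])\<close> over the field \<open>'k\<close>; the second index is the
  internal degree.\<close>

definition betti :: "'k::field itself \<Rightarrow> 'v set \<Rightarrow> 'v set set \<Rightarrow> nat \<Rightarrow> nat \<Rightarrow> nat" where
  "betti k V \<Gamma> i e =
     tor_dim V (sr_ideal V \<Gamma> :: ('v, 'k) mpoly set) (irrelevant_ideal V) i e"

end

theory Submission
  imports Defs
begin

text \<open>
  Let \<open>F\<close> be a facet of \<open>\<Gamma>\<close> and \<open>\<Gamma>' = \<Gamma> - {F}\<close>. Multiplication by \<open>x\<^sub>F\<close> gives a short exact sequence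
  \<open>0 \<rightarrow> (S/(x\<^sub>v | v \<notin> F))(-|F|) \<rightarrow> \<F>[\<Gamma>] \<rightarrow> \<F>[\<Gamma>'] \<rightarrow> 0\<close>, and \<open>Tor\<^sub>i\<close> of the first term lives in internal
  degree \<open>i + |F|\<close> only. In degree \<open>i + j\<close> the long exact sequence therefore makes
  \<open>Tor\<^sub>i(\<F>[\<Gamma>]) \<rightarrow> Tor\<^sub>i(\<F>[\<Gamma>'])\<close> injective if \<open>|F| > j\<close> and surjective if \<open>|F| \<le> j\<close>. Hence deleting
  all faces with more than \<open>j\<close> vertices from \<open>\<Delta>\<close>, and then adding the missing faces of the clique
  complex with at most \<open>j\<close> vertices, can only increase \<open>\<beta>\<^sub>i\<^sub>,\<^sub>i\<^sub>+\<^sub>j\<close>.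

  The chases work in any resolution of the residue field and use only its exactness; that a
  resolution exists is needed because \<open>tor_dim\<close> picks one with \<open>SOME\<close>. It is built from iterated
  mapping cones of the variables.
\<close>

section \<open>Dimensions of quotients\<close>

context vector_space
begin

text \<open>Extending a basis \<open>b\<close> of \<open>B\<close> by \<open>c\<close> to a basis of
  \<open>Z\<close> turns the truncated difference \<open>dim Z - dim B\<close> into
  \<open>card c\<close>. Such differences are how Betti numbers are defined; the finite set
  \<open>E\<close> keeps \<open>dim\<close> meaningful.\<close>

lemma subspace_pair_bases:
  assumes "subspace B" "subspace Z" "B \<subseteq> Z" "Z \<subseteq> span E" "finite E"
  obtains b c where "finite b" "finite c" "b \<inter> c = {}" "independent (b \<union> c)"
    "span b = B" "span (b \<union> c) = Z" "dim B = card b" "dim Z = card b + card c"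
proof -
  obtain b where b: "b \<subseteq> B" "independent b" "B \<subseteq> span b"
    using maximal_independent_subset by blast
  obtain bc where bc: "b \<subseteq> bc" "bc \<subseteq> Z" "independent bc" "Z \<subseteq> span bc"
    using maximal_independent_subset_extend[of b Z] b assms(3) by blast
  have fin: "finite bc"
    using independent_span_bound[OF assms(5) bc(3)] bc(2) assms(4) by blast
  have span_b: "span b = B" and span_bc: "span bc = Z"
    using b(1,3) bc(2,4) assms(1,2) by (simp_all add: span_minimal subset_antisym)
  have dims: "dim B = card b" "dim Z = card bc"
    using b bc basis_card_eq_dim[of b B] basis_card_eq_dim[of bc Z] by simp_all
  have bc_eq: "b \<union> (bc - b) = bc"
    using bc(1) by blast
  have "card bc = card b + card (bc - b)"
    using bc(1) fin by (metis bc_eq Diff_disjoint card_Un_disjoint finite_Diff finite_subset)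
  then show ?thesis
    using that[of b "bc - b"] fin finite_subset[OF bc(1)] bc(3) span_b span_bc dims bc_eq by auto
qed

text \<open>Modulo \<open>B2\<close>, representatives \<open>c1\<close> of a basis of
  \<open>Z1/B1\<close> generate all of \<open>Z2\<close>, so \<open>c1\<close> and a basis of
  \<open>B2\<close> together span \<open>Z2\<close>.\<close>

lemma dim_quotient_le_surj:
  assumes "subspace B1" "subspace Z1" "subspace B2" "subspace Z2"
    and "B1 \<subseteq> Z1" "B2 \<subseteq> Z2" "B1 \<subseteq> B2"
    and E: "Z1 \<subseteq> span E" "Z2 \<subseteq> span E" "finite E"
    and surj: "\<And>z. z \<in> Z2 \<Longrightarrow> \<exists>y\<in>Z1. z - y \<in> B2"
  shows "dim Z2 - dim B2 \<le> dim Z1 - dim B1"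
proof -
  obtain b1 c1 where 1: "finite b1" "finite c1" "b1 \<inter> c1 = {}" "independent (b1 \<union> c1)"
      "span b1 = B1" "span (b1 \<union> c1) = Z1" "dim B1 = card b1" "dim Z1 = card b1 + card c1"
    using subspace_pair_bases[of B1 Z1 E] assms by metis
  obtain b2 c2 where 2: "finite b2" "span b2 = B2" "dim B2 = card b2"
    using subspace_pair_bases[of B2 Z2 E] assms by metis
  have "Z2 \<subseteq> span (c1 \<union> b2)"
  proof
    fix z assume "z \<in> Z2"
    then obtain y where y: "y \<in> Z1" "z - y \<in> B2" using surj by blast
    have "b1 \<union> c1 \<subseteq> span (c1 \<union> b2)"
      using 1(5) 2(2) assms(7) span_superset[of b1] span_mono[of b2 "c1 \<union> b2"]
        span_superset[of "c1 \<union> b2"] by blast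
    then have "y \<in> span (c1 \<union> b2)"
      using y(1) 1(6) span_minimal[OF _ subspace_span] by blast
    moreover have "z - y \<in> span (c1 \<union> b2)"
      using y(2) 2(2) span_mono[of b2 "c1 \<union> b2"] by blast
    ultimately have "(z - y) + y \<in> span (c1 \<union> b2)" by (rule span_add[rotated])
    then show "z \<in> span (c1 \<union> b2)" by simp
  qed
  then have "dim Z2 \<le> card (c1 \<union> b2)"
    using 1(2) 2(1) by (intro dim_le_card) auto
  also have "\<dots> \<le> card c1 + card b2" by (rule card_Un_le)
  finally show ?thesis using 1(7,8) 2(3) by linarith
qed

text \<open>The condition \<open>Z1 \<inter> B2 \<subseteq> B1\<close> is injectivity of
  \<open>Z1/B1\<close> into \<open>Z2/B2\<close>, so \<open>c1\<close> remains independent modulo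
  \<open>B2\<close>.\<close>

lemma dim_quotient_le_inj:
  assumes "subspace B1" "subspace Z1" "subspace B2" "subspace Z2"
    and "B1 \<subseteq> Z1" "B2 \<subseteq> Z2" "Z1 \<subseteq> Z2"
    and E: "Z2 \<subseteq> span E" "finite E"
    and inj: "Z1 \<inter> B2 \<subseteq> B1"
  shows "dim Z1 - dim B1 \<le> dim Z2 - dim B2"
proof -
  obtain b1 c1 where 1: "finite b1" "finite c1" "b1 \<inter> c1 = {}" "independent (b1 \<union> c1)"
      "span b1 = B1" "span (b1 \<union> c1) = Z1" "dim B1 = card b1" "dim Z1 = card b1 + card c1"
    using subspace_pair_bases[OF assms(1,2,5) subset_trans[OF assms(7) E(1)] E(2)] by metis
  obtain b2 c2 where 2: "finite b2" "span b2 = B2" "dim B2 = card b2" "independent (b2 \<union> c2)"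
    using subspace_pair_bases[of B2 Z2 E] assms by metis
  \<comment> \<open>The elements of \<open>c1\<close> are adjoined to \<open>b2\<close> one at a
    time.\<close>
  have "independent (b2 \<union> c) \<and> card (b2 \<union> c) = card b2 + card c" if "c \<subseteq> c1" for c
    using finite_subset[OF that 1(2)] that
  proof (induction c rule: finite_induct)
    case empty
    then show ?case using 2 independent_mono[of "b2 \<union> c2" b2] by auto
  next
    case (insert x c)
    have "x \<notin> span (b2 \<union> c)"
    proof
      \<comment> \<open>A dependence \<open>x = u + v\<close> puts \<open>u = x - v\<close> into
        \<open>Z1 \<inter> B2\<close>, hence into \<open>B1\<close>; then \<open>x\<close> depends
        on \<open>b1 \<union> c\<close>, against the independence of
        \<open>b1 \<union> c1\<close>.\<close>
      assume "x \<in> span (b2 \<union> c)"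
      then obtain u v where uv: "x = u + v" "u \<in> B2" "v \<in> span c"
        unfolding span_Un 2(2) by blast
      have "x \<in> span (b1 \<union> c1)" "v \<in> span (b1 \<union> c1)"
        using insert.prems uv(3) span_mono[of c "b1 \<union> c1"] by (auto intro: span_base)
      then have "x - v \<in> Z1" unfolding 1(6)[symmetric] by (rule span_diff)
      then have "u \<in> Z1" using uv(1) by simp
      then have "u \<in> span b1" using inj uv(2) 1(5) by auto
      then have "u \<in> span (b1 \<union> c)" using span_mono[of b1 "b1 \<union> c"] by blast
      moreover have "v \<in> span (b1 \<union> c)" using uv(3) span_mono[of c "b1 \<union> c"] by blast
      ultimately have "x \<in> span (b1 \<union> c)" unfolding uv(1) by (rule span_add)
      moreover have "independent (insert x (b1 \<union> c))"
        using 1(4) by (rule independent_mono) (use insert.prems in auto)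
      moreover have "x \<notin> b1 \<union> c" using insert.hyps insert.prems 1(3) by blast
      ultimately show False by (simp add: independent_insert)
    qed
    moreover from this have "x \<notin> b2 \<union> c" using span_base by blast
    ultimately have "independent (insert x (b2 \<union> c))" "card (insert x (b2 \<union> c)) = Suc (card (b2 \<union> c))"
      using insert.IH insert.prems insert.hyps 2(1) by (auto simp add: independent_insert)
    then show ?case using insert.IH insert.prems insert.hyps by simp
  qed
  from this[of c1] have ind: "independent (b2 \<union> c1)" and card: "card (b2 \<union> c1) = card b2 + card c1"
    by auto
  have "b2 \<union> c1 \<subseteq> Z2"
    using span_superset[of b2] span_superset[of "b1 \<union> c1"] assms(6,7) unfolding 1(6) 2(2) by blast
  moreover obtain bz where bz: "bz \<subseteq> Z2" "independent bz" "Z2 \<subseteq> span bz" "card bz = dim Z2"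
    using basis_exists[of Z2] by blast
  ultimately have "b2 \<union> c1 \<subseteq> span bz" by blast
  moreover have "finite bz"
    using independent_span_bound[OF E(2) bz(2)] subset_trans[OF bz(1) E(1)] by blast
  ultimately have "card (b2 \<union> c1) \<le> dim Z2"
    using independent_span_bound[of bz "b2 \<union> c1"] ind unfolding bz(4) by blast
  then show ?thesis using card 1(7,8) 2(3) by linarith
qed

end

section \<open>Monomial ideals\<close>

text \<open>The vector space spanned by the monomials with exponents in \<open>M\<close>. The ideals
  and graded pieces below all take this form, so membership becomes a condition on single
  exponents.\<close>

definition pspan :: "('v \<Rightarrow>\<^sub>0 nat) set \<Rightarrow> ('v, 'k::field) mpoly set" where
  "pspan M = {p. Poly_Mapping.keys p \<subseteq> M}"

lemma pspan_0 [simp]: "0 \<in> pspan M"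
  by (simp add: pspan_def)

lemma pspan_add: "p \<in> pspan M \<Longrightarrow> q \<in> pspan M \<Longrightarrow> p + q \<in> pspan M"
  using Poly_Mapping.keys_add[of p q] by (auto simp: pspan_def)

lemma pspan_uminus: "p \<in> pspan M \<Longrightarrow> - p \<in> pspan M"
  by (auto simp: pspan_def in_keys_iff subset_iff)

lemma pspan_diff: "p \<in> pspan M \<Longrightarrow> q \<in> pspan M \<Longrightarrow> p - q \<in> pspan M"
  using pspan_add[of p M "- q"] pspan_uminus[of q M] by simp

lemma pspan_sum: "(\<And>i. i \<in> S \<Longrightarrow> f i \<in> pspan M) \<Longrightarrow> sum f S \<in> pspan M"
  by (induction S rule: infinite_finite_induct) (auto intro: pspan_add)

lemma pspan_mult:
  assumes "p \<in> pspan M" "q \<in> pspan M'" "\<And>m m'. m \<in> M \<Longrightarrow> m' \<in> M' \<Longrightarrow> m + m' \<in> M''"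
  shows "p * q \<in> pspan M''"
  using Poly_Mapping.keys_mult[of p q] assms unfolding pspan_def by blast

lemma pspan_mono: "p \<in> pspan M \<Longrightarrow> M \<subseteq> M' \<Longrightarrow> p \<in> pspan M'"
  by (auto simp: pspan_def)

lemma pspan_disjoint_eq_0: "p \<in> pspan M \<Longrightarrow> p \<in> pspan M' \<Longrightarrow> M \<inter> M' = {} \<Longrightarrow> p = 0"
  unfolding pspan_def using keys_eq_empty[of p] by blast

lemma poly_ring_eq_pspan: "poly_ring V = pspan {m. Poly_Mapping.keys m \<subseteq> V}"
  by (auto simp: poly_ring_def pspan_def)

lemma poly_eq_sum_monomials:
  "p = (\<Sum>m\<in>Poly_Mapping.keys p. Poly_Mapping.single m (Poly_Mapping.lookup p m))"
  by (rule poly_mapping_eqI)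
    (simp add: lookup_sum lookup_single when_def sum.delta in_keys_iff)

lemma pspan_split:
  assumes "p \<in> pspan (M \<union> M')"
  obtains q r where "p = q + r" "q \<in> pspan M" "r \<in> pspan M'"
    "Poly_Mapping.keys q \<subseteq> Poly_Mapping.keys p" "Poly_Mapping.keys r \<subseteq> Poly_Mapping.keys p"
proof -
  \<comment> \<open>Exponents lying in both sets are assigned to the first summand.\<close>
  let ?q = "Poly_Mapping.mapp (\<lambda>m c. if m \<in> M then c else 0) p"
  let ?r = "Poly_Mapping.mapp (\<lambda>m c. if m \<in> M then 0 else c) p"
  have "p = ?q + ?r"
    by (rule poly_mapping_eqI) (auto simp: lookup_add lookup_mapp in_keys_iff when_def)
  moreover have "?q \<in> pspan M"
    by (auto simp: pspan_def in_keys_iff lookup_mapp when_def split: if_splits)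
  moreover have "?r \<in> pspan M'"
    using assms by (auto simp: pspan_def in_keys_iff lookup_mapp when_def subset_iff split: if_splits)
  ultimately show ?thesis
    using that keys_mapp_subset by metis
qed

lemma lookup_monomial_mult:
  fixes z :: "('v, 'k::field) mpoly"
  shows "Poly_Mapping.lookup (Poly_Mapping.single a 1 * z) (a + m) = Poly_Mapping.lookup z m"
proof -
  have "Poly_Mapping.single a 1 * z
      = Poly_Mapping.single a 1 * (\<Sum>n\<in>Poly_Mapping.keys z. Poly_Mapping.single n (Poly_Mapping.lookup z n))"
    by (rule arg_cong[OF poly_eq_sum_monomials])
  also have "\<dots> = (\<Sum>n\<in>Poly_Mapping.keys z. Poly_Mapping.single (a + n) (Poly_Mapping.lookup z n))"
    by (simp add: sum_distrib_left mult_single)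
  finally show ?thesis
    by (simp add: lookup_sum lookup_single when_def sum.delta in_keys_iff)
qed

text \<open>Multiplication by a monomial translates exponents injectively, so nothing cancels and
  every monomial of \<open>z\<close> can be read off the product.\<close>

lemma pspan_colon:
  fixes z :: "('v, 'k::field) mpoly"
  assumes "Poly_Mapping.single a 1 * z \<in> pspan M"
  shows "z \<in> pspan {m. a + m \<in> M}"
  using assms unfolding pspan_def
  by (auto simp: in_keys_iff subset_iff) (metis lookup_monomial_mult)

lemma pspan_divide:
  fixes p :: "('v, 'k::field) mpoly"
  assumes "p \<in> pspan M" "\<And>m. m \<in> M \<Longrightarrow> \<exists>n\<in>M'. m = a + n"
  obtains z where "p = Poly_Mapping.single a 1 * z" "z \<in> pspan M'"
proof -
  have "\<forall>m\<in>Poly_Mapping.keys p. \<exists>n\<in>M'. m = a + n"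
    using assms by (auto simp: pspan_def)
  then obtain g where g: "\<And>m. m \<in> Poly_Mapping.keys p \<Longrightarrow> g m \<in> M' \<and> m = a + g m"
    by metis
  let ?z = "\<Sum>m\<in>Poly_Mapping.keys p. Poly_Mapping.single (g m) (Poly_Mapping.lookup p m)"
  have "p = (\<Sum>m\<in>Poly_Mapping.keys p. Poly_Mapping.single (a + g m) (Poly_Mapping.lookup p m))"
    using g by (subst poly_eq_sum_monomials[of p]) (intro sum.cong, auto)
  also have "\<dots> = Poly_Mapping.single a 1 * ?z"
    by (simp add: sum_distrib_left mult_single)
  finally have "p = Poly_Mapping.single a 1 * ?z" .
  moreover have "?z \<in> pspan M'"
    by (rule pspan_sum) (use g in \<open>auto simp: pspan_def\<close>)
  ultimately show ?thesis using that by blast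
qed

section \<open>Supports, degrees and squarefree monomial ideals\<close>

lemma keys_monomial_add:
  "Poly_Mapping.keys (m + n :: 'v \<Rightarrow>\<^sub>0 nat) = Poly_Mapping.keys m \<union> Poly_Mapping.keys n"
  by (auto simp: in_keys_iff lookup_add)

lemma mono_deg_alt:
  "finite S \<Longrightarrow> Poly_Mapping.keys m \<subseteq> S \<Longrightarrow> mono_deg m = (\<Sum>v\<in>S. Poly_Mapping.lookup m v)"
  unfolding mono_deg_def by (rule sum.mono_neutral_left) (auto simp: in_keys_iff)

lemma mono_deg_add: "mono_deg (m + n) = mono_deg m + mono_deg n"
proof -
  let ?S = "Poly_Mapping.keys m \<union> Poly_Mapping.keys n"
  have "mono_deg (m + n) = (\<Sum>v\<in>?S. Poly_Mapping.lookup (m + n) v)"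
    by (rule mono_deg_alt) (auto simp: keys_monomial_add)
  then show ?thesis
    using mono_deg_alt[of ?S m] mono_deg_alt[of ?S n] by (simp add: lookup_add sum.distrib)
qed

lemma finite_monomials:
  assumes "finite V"
  shows "finite {m. Poly_Mapping.keys m \<subseteq> V \<and> mono_deg m \<le> e}" (is "finite ?M")
proof -
  have "Poly_Mapping.lookup ` ?M \<subseteq> {f. \<forall>v. (v \<in> V \<longrightarrow> f v \<in> {..e}) \<and> (v \<notin> V \<longrightarrow> f v = 0)}"
  proof clarsimp
    fix m v assume m: "Poly_Mapping.keys m \<subseteq> V" "mono_deg m \<le> e"
    have "Poly_Mapping.lookup m v \<le> mono_deg m" if "v \<in> V"
      unfolding mono_deg_alt[OF assms m(1)] using assms that by (simp add: member_le_sum)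
    then show "(v \<in> V \<longrightarrow> Poly_Mapping.lookup m v \<le> e) \<and> (v \<notin> V \<longrightarrow> Poly_Mapping.lookup m v = 0)"
      using m by (auto simp: in_keys_iff)
  qed
  then have "finite (Poly_Mapping.lookup ` ?M)"
    using finite_set_of_finite_funs[OF assms, of "{..e}" 0] finite_subset by blast
  then show ?thesis
    by (rule finite_imageD) (simp add: inj_on_def)
qed

definition sqfree :: "'v set \<Rightarrow> 'v \<Rightarrow>\<^sub>0 nat" where
  "sqfree F = (\<Sum>v\<in>F. Poly_Mapping.single v 1)"

lemma lookup_sqfree: "finite F \<Longrightarrow> Poly_Mapping.lookup (sqfree F) v = (if v \<in> F then 1 else 0)"
  by (simp add: sqfree_def lookup_sum lookup_single when_def sum.delta)

lemma keys_sqfree: "finite F \<Longrightarrow> Poly_Mapping.keys (sqfree F) = F"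
  by (auto simp: in_keys_iff lookup_sqfree split: if_splits)

lemma mono_deg_sqfree: "finite F \<Longrightarrow> mono_deg (sqfree F) = card F"
  by (simp add: mono_deg_def keys_sqfree lookup_sqfree)

lemma sqfree_divides:
  assumes "finite F" "F \<subseteq> Poly_Mapping.keys m"
  shows "\<exists>n. m = sqfree F + n"
proof
  show "m = sqfree F + (m - sqfree F)"
    using assms
    by (intro poly_mapping_eqI) (auto simp: lookup_add lookup_minus lookup_sqfree in_keys_iff Suc_le_eq)
qed

lemma prod_var: "(\<Prod>v\<in>F. var v) = Poly_Mapping.single (sqfree F) (1::'k::field)"
  by (induction F rule: infinite_finite_induct) (simp_all add: sqfree_def var_def mult_single)

text \<open>Replaces generators and coefficients, as used for Stanley-Reisner and irrelevant ideals,
  by a condition on supports: \<open>x\<^sub>F\<close> divides a monomial iff \<open>F\<close> lies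
  in its support.\<close>

lemma ideal_gen_sqfree:
  assumes "finite V" and "\<And>F. F \<in> \<F> \<Longrightarrow> F \<subseteq> V"
  shows "ideal_gen V {(\<Prod>v\<in>F. var v) | F. F \<in> \<F>} =
    (pspan {m. Poly_Mapping.keys m \<subseteq> V \<and> (\<exists>F\<in>\<F>. F \<subseteq> Poly_Mapping.keys m)} :: ('v, 'k::field) mpoly set)"
    (is "?L = ?R")
proof
  show "?L \<subseteq> ?R"
  proof
    fix p :: "('v, 'k) mpoly" assume "p \<in> ?L"
    then obtain A c where p: "p = (\<Sum>g\<in>A. c g * g)" "A \<subseteq> {(\<Prod>v\<in>F. var v) | F. F \<in> \<F>}"
        "\<forall>g\<in>A. c g \<in> poly_ring V"
      unfolding ideal_gen_def by blast
    show "p \<in> ?R"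
      unfolding p(1)
    proof (rule pspan_sum)
      fix g assume g: "g \<in> A"
      then obtain F where F: "F \<in> \<F>" "g = (\<Prod>v\<in>F. var v)" using p(2) by blast
      have "g \<in> pspan {sqfree F}" using F by (simp add: prod_var pspan_def)
      moreover have "c g \<in> pspan {m. Poly_Mapping.keys m \<subseteq> V}"
        using p(3) g by (simp add: poly_ring_eq_pspan)
      ultimately show "c g * g \<in> ?R"
        using F(1) assms finite_subset[OF assms(2)[OF F(1)]]
        by (elim pspan_mult[rotated]) (auto simp: keys_monomial_add keys_sqfree)
    qed
  qed
next
  show "?R \<subseteq> ?L"
  proof
    fix p :: "('v, 'k) mpoly" assume p: "p \<in> ?R"
    let ?K = "Poly_Mapping.keys p"
    have "\<forall>m\<in>?K. \<exists>F n. F \<in> \<F> \<and> m = sqfree F + n"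
    proof
      fix m assume "m \<in> ?K"
      then obtain F where "F \<in> \<F>" "F \<subseteq> Poly_Mapping.keys m" using p by (auto simp: pspan_def)
      then show "\<exists>F n. F \<in> \<F> \<and> m = sqfree F + n"
        using sqfree_divides assms finite_subset by metis
    qed
    then obtain F n where Fn: "\<And>m. m \<in> ?K \<Longrightarrow> F m \<in> \<F>" "\<And>m. m \<in> ?K \<Longrightarrow> m = sqfree (F m) + n m"
      by metis
    define g :: "('v \<Rightarrow>\<^sub>0 nat) \<Rightarrow> ('v, 'k) mpoly" where "g m = (\<Prod>v\<in>F m. var v)" for m
    \<comment> \<open>\<open>ideal_gen\<close> allows one coefficient per generator, whereas several
      monomials of \<open>p\<close> may use the same generator; their cofactors are added
      up.\<close>
    define c :: "('v, 'k) mpoly \<Rightarrow> ('v, 'k) mpoly" where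
      "c y = (\<Sum>m | m \<in> ?K \<and> g m = y. Poly_Mapping.single (n m) (Poly_Mapping.lookup p m))" for y
    have "p = (\<Sum>m\<in>?K. Poly_Mapping.single (n m) (Poly_Mapping.lookup p m) * g m)"
      by (subst poly_eq_sum_monomials[of p], intro sum.cong)
        (use Fn(2) in \<open>auto simp: g_def prod_var mult_single add.commute\<close>)
    also have "\<dots> = (\<Sum>y\<in>g ` ?K. c y * y)"
      by (subst sum.image_gen[of _ _ g])
        (auto simp: c_def sum_distrib_right intro!: sum.cong)
    finally have "p = (\<Sum>y\<in>g ` ?K. c y * y)" .
    moreover have "c y \<in> poly_ring V" for y
      unfolding c_def poly_ring_eq_pspan
    proof (rule pspan_sum)
      fix m assume m: "m \<in> {m \<in> ?K. g m = y}"
      then have "Poly_Mapping.keys (n m) \<subseteq> Poly_Mapping.keys m"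
        using Fn(2)[of m] keys_monomial_add[of "sqfree (F m)" "n m"] by simp
      then show "Poly_Mapping.single (n m) (Poly_Mapping.lookup p m) \<in> pspan {m. Poly_Mapping.keys m \<subseteq> V}"
        using p m by (auto simp: pspan_def)
    qed
    ultimately show "p \<in> ?L"
      unfolding ideal_gen_def using Fn(1)
      by (intro CollectI exI[of _ "g ` ?K"] exI[of _ c]) (auto simp: g_def)
  qed
qed

text \<open>For monotone (upward closed) \<open>N\<close> this is a squarefree monomial ideal.
  Encoding it by a predicate makes the needed operations explicit: adding \<open>x\<^sub>F\<close>
  gives \<open>N X \<or> F \<subseteq> X\<close>, the colon by \<open>x\<^sub>F\<close> gives
  \<open>N (F \<union> X)\<close>.\<close>

definition supp_ideal :: "'v set \<Rightarrow> ('v set \<Rightarrow> bool) \<Rightarrow> ('v, 'k::field) mpoly set" where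
  "supp_ideal V N = pspan {m. Poly_Mapping.keys m \<subseteq> V \<and> N (Poly_Mapping.keys m)}"

lemma supp_ideal_cong: "(\<And>X. X \<subseteq> V \<Longrightarrow> N X = N' X) \<Longrightarrow> supp_ideal V N = supp_ideal V N'"
  unfolding supp_ideal_def by (rule arg_cong[where f = pspan]) blast

lemma sr_ideal_eq_pspan:
  assumes "simplicial_complex V \<Gamma>"
  shows "sr_ideal V \<Gamma> = supp_ideal V (\<lambda>X. X \<notin> \<Gamma>)"
proof -
  let ?\<F> = "{F. F \<subseteq> V \<and> F \<notin> \<Gamma>}"
  have "(\<exists>F\<in>?\<F>. F \<subseteq> X) \<longleftrightarrow> X \<notin> \<Gamma>" if "X \<subseteq> V" for X
    using assms that unfolding simplicial_complex_def by blast
  then have eq: "{m. Poly_Mapping.keys m \<subseteq> V \<and> (\<exists>F\<in>?\<F>. F \<subseteq> Poly_Mapping.keys m)}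
     = {m. Poly_Mapping.keys m \<subseteq> V \<and> Poly_Mapping.keys m \<notin> \<Gamma>}" by blast
  have "finite V" using assms by (simp add: simplicial_complex_def)
  from ideal_gen_sqfree[OF this, of ?\<F>, unfolded eq] show ?thesis
    by (simp add: sr_ideal_def supp_ideal_def)
qed

text \<open>Written with \<open>X \<inter> V\<close> so as to be the case \<open>W = V\<close> of
  the ideals generated by the variables in \<open>W\<close>, over which the later inductions
  run.\<close>

lemma irrelevant_ideal_eq:
  assumes "finite V"
  shows "irrelevant_ideal V = supp_ideal V (\<lambda>X. X \<inter> V \<noteq> {})"
proof -
  let ?\<F> = "(\<lambda>v. {v}) ` V"
  have gens: "{(\<Prod>v\<in>F. var v) | F. F \<in> ?\<F>} = var ` V"
    by (auto intro: exI[of _ "{_}"])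
  have eq: "{m. Poly_Mapping.keys m \<subseteq> V \<and> (\<exists>F\<in>?\<F>. F \<subseteq> Poly_Mapping.keys m)}
     = {m. Poly_Mapping.keys m \<subseteq> V \<and> Poly_Mapping.keys m \<inter> V \<noteq> {}}" by blast
  show ?thesis
    using ideal_gen_sqfree[OF assms, of ?\<F>, unfolded eq gens]
    by (auto simp: irrelevant_ideal_def supp_ideal_def)
qed

lemma supp_ideal_mult:
  assumes "p \<in> supp_ideal V N" "q \<in> poly_ring V" "mono N"
  shows "p * q \<in> supp_ideal V N"
proof -
  have "N (X \<union> Y)" if "N X" for X Y
    using monoD[OF assms(3), of X "X \<union> Y"] that by (simp add: le_bool_def)
  then show ?thesis
    using assms(1,2) unfolding supp_ideal_def poly_ring_eq_pspan
    by (elim pspan_mult) (auto simp: keys_monomial_add)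
qed

lemma supp_ideal_colon:
  fixes z :: "('v, 'k::field) mpoly"
  assumes "Poly_Mapping.single (sqfree F) 1 * z \<in> supp_ideal V N" "finite F"
  shows "z \<in> supp_ideal V (\<lambda>X. N (F \<union> X))"
  using pspan_colon[OF assms(1)[unfolded supp_ideal_def]] unfolding supp_ideal_def
  by (rule pspan_mono) (auto simp: keys_monomial_add keys_sqfree assms(2))

lemma supp_ideal_colon_mult:
  fixes z :: "('v, 'k::field) mpoly"
  assumes "z \<in> supp_ideal V (\<lambda>X. N (F \<union> X))" "finite F" "F \<subseteq> V"
  shows "Poly_Mapping.single (sqfree F) 1 * z \<in> supp_ideal V N"
  unfolding supp_ideal_def
proof (rule pspan_mult)
  show "Poly_Mapping.single (sqfree F) 1 \<in> pspan {sqfree F}" by (simp add: pspan_def)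
qed (use assms in \<open>auto simp: supp_ideal_def keys_monomial_add keys_sqfree\<close>)

section \<open>Cycles and boundaries modulo a monomial ideal\<close>

text \<open>The extra shift \<open>t\<close> stands for internal degree \<open>e - t\<close> without truncated subtraction.\<close>

definition graded_shift ::
    "'v set \<Rightarrow> ('v, 'k::field) free_cplx \<Rightarrow> nat \<Rightarrow> nat \<Rightarrow> nat \<Rightarrow> (nat \<Rightarrow> ('v, 'k) mpoly) set" where
  "graded_shift V P i t e =
     {x. (\<forall>k < rk P i. x k \<in> pspan {m. Poly_Mapping.keys m \<subseteq> V \<and> mono_deg m + sh P i k + t = e})
       \<and> (\<forall>k \<ge> rk P i. x k = 0)}"

lemma graded_shift_0: "graded_shift V P i 0 e = graded_part V P i e"
  by (auto simp: graded_shift_def graded_part_def free_mod_def poly_ring_def pspan_def subset_iff)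

lemma graded_shift_free_mod: "x \<in> graded_shift V P i t e \<Longrightarrow> x \<in> free_mod V (rk P i)"
  by (auto simp: graded_shift_def free_mod_def poly_ring_eq_pspan intro: pspan_mono)

lemma graded_shift_zero: "(\<lambda>k. 0) \<in> graded_shift V P i t e"
  by (simp add: graded_shift_def)

lemma graded_shift_add:
  "x \<in> graded_shift V P i t e \<Longrightarrow> y \<in> graded_shift V P i t e \<Longrightarrow> (\<lambda>k. x k + y k) \<in> graded_shift V P i t e"
  by (simp add: graded_shift_def pspan_add)

lemma graded_shift_diff:
  "x \<in> graded_shift V P i t e \<Longrightarrow> y \<in> graded_shift V P i t e \<Longrightarrow> (\<lambda>k. x k - y k) \<in> graded_shift V P i t e"
  by (simp add: graded_shift_def pspan_diff)

lemma graded_shift_monomial_mult: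
  assumes "z \<in> graded_shift V P i (t + card F) e" "finite F" "F \<subseteq> V"
  shows "(\<lambda>k. Poly_Mapping.single (sqfree F) 1 * z k) \<in> graded_shift V P i t e"
proof -
  have "Poly_Mapping.single (sqfree F) 1 * z k
      \<in> pspan {m. Poly_Mapping.keys m \<subseteq> V \<and> mono_deg m + sh P i k + t = e}" if k: "k < rk P i" for k
  proof (rule pspan_mult)
    show "Poly_Mapping.single (sqfree F) 1 \<in> pspan {sqfree F}" by (simp add: pspan_def)
    show "z k \<in> pspan {m. Poly_Mapping.keys m \<subseteq> V \<and> mono_deg m + sh P i k + (t + card F) = e}"
      using assms(1) k by (simp add: graded_shift_def)
  qed (use assms in \<open>auto simp: keys_monomial_add keys_sqfree mono_deg_add mono_deg_sqfree\<close>)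
  then show ?thesis using assms(1) by (simp add: graded_shift_def)
qed

text \<open>A homogeneous vector over \<open>I + (x\<^sub>F)\<close> splits homogeneously, monomial
  by monomial. Dividing by \<open>x\<^sub>F\<close> lowers the internal degree by
  \<open>card F\<close>, which the shift records.\<close>

lemma graded_shift_split:
  fixes P :: "('v, 'k::field) free_cplx"
  assumes x: "x \<in> graded_shift V P i t e" "\<And>k. x k \<in> supp_ideal V (\<lambda>X. N X \<or> F \<subseteq> X)"
    and "finite F"
  obtains w z where "\<And>k. x k = w k + Poly_Mapping.single (sqfree F) 1 * z k"
    "\<And>k. w k \<in> supp_ideal V N" "w \<in> graded_shift V P i t e" "z \<in> graded_shift V P i (t + card F) e"
proof -
  \<comment> \<open>\<open>R\<close> gathers the requirements on one coordinate, with zeros forced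
    beyond the rank, so that \<open>w\<close> and \<open>z\<close> can be chosen
    coordinatewise.\<close>
  define R where "R k q z \<longleftrightarrow> x k = q + Poly_Mapping.single (sqfree F) 1 * z \<and> q \<in> supp_ideal V N
      \<and> (if k < rk P i
         then q \<in> pspan {m. Poly_Mapping.keys m \<subseteq> V \<and> mono_deg m + sh P i k + t = e}
          \<and> z \<in> pspan {m. Poly_Mapping.keys m \<subseteq> V \<and> mono_deg m + sh P i k + (t + card F) = e}
         else q = 0 \<and> z = 0)" for k and q z :: "('v, 'k) mpoly"
  have "\<exists>q z. R k q z" for k
  proof (cases "k < rk P i")
    case True
    let ?M = "{m. Poly_Mapping.keys m \<subseteq> V \<and> mono_deg m + sh P i k + t = e}"
    let ?M' = "{m. Poly_Mapping.keys m \<subseteq> V \<and> mono_deg m + sh P i k + (t + card F) = e}"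
    have "x k \<in> pspan ?M" using x(1) True by (simp add: graded_shift_def)
    then have "x k \<in> pspan ({m \<in> ?M. N (Poly_Mapping.keys m)} \<union> {m \<in> ?M. F \<subseteq> Poly_Mapping.keys m})"
      using x(2)[of k] by (auto simp: supp_ideal_def pspan_def)
    then obtain q r where qr: "x k = q + r" "q \<in> pspan {m \<in> ?M. N (Poly_Mapping.keys m)}"
        "r \<in> pspan {m \<in> ?M. F \<subseteq> Poly_Mapping.keys m}"
      by (rule pspan_split)
    obtain z where z: "r = Poly_Mapping.single (sqfree F) 1 * z" "z \<in> pspan ?M'"
    proof (rule pspan_divide[OF qr(3)])
      fix m assume m: "m \<in> {m \<in> ?M. F \<subseteq> Poly_Mapping.keys m}"
      then obtain n where n: "m = sqfree F + n" using sqfree_divides[OF assms(3)] by blast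
      with m show "\<exists>n\<in>?M'. m = sqfree F + n"
        by (intro bexI[of _ n])
          (auto simp: keys_monomial_add mono_deg_add mono_deg_sqfree[OF assms(3)])
    qed
    have "q \<in> pspan ?M" "q \<in> supp_ideal V N"
      using qr(2) by (auto simp: supp_ideal_def elim: pspan_mono)
    with True qr(1) z show ?thesis by (intro exI[of _ q] exI[of _ z]) (simp add: R_def)
  next
    case False
    moreover from this have "x k = 0" using x(1) by (simp add: graded_shift_def)
    ultimately show ?thesis by (intro exI[of _ 0]) (simp add: R_def supp_ideal_def)
  qed
  then obtain w where "\<And>k. \<exists>z. R k (w k) z" by metis
  then obtain z where wz: "\<And>k. R k (w k) (z k)" by metis
  have "w k = 0" "z k = 0" if "k \<ge> rk P i" for k
    using wz[of k] that by (simp_all add: R_def)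
  moreover have "w k \<in> pspan {m. Poly_Mapping.keys m \<subseteq> V \<and> mono_deg m + sh P i k + t = e}"
      "z k \<in> pspan {m. Poly_Mapping.keys m \<subseteq> V \<and> mono_deg m + sh P i k + (t + card F) = e}"
    if "k < rk P i" for k
    using wz[of k] that by (simp_all add: R_def)
  ultimately have "w \<in> graded_shift V P i t e" "z \<in> graded_shift V P i (t + card F) e"
    unfolding graded_shift_def by blast+
  then show ?thesis using that[of w z] wz unfolding R_def by blast
qed

lemma diff_map_add: "diff_map P i (\<lambda>k. x k + y k) l = diff_map P i x l + diff_map P i y l"
  by (simp add: diff_map_def sum.distrib distrib_right)

lemma diff_map_diff: "diff_map P i (\<lambda>k. x k - y k) l = diff_map P i x l - diff_map P i y l"
  by (simp add: diff_map_def sum_subtractf left_diff_distrib)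

lemma diff_map_mult: "diff_map P i (\<lambda>k. c * x k) l = c * diff_map P i x l"
  by (simp add: diff_map_def sum_distrib_left mult.assoc)

lemma diff_map_zero [simp]: "diff_map P i (\<lambda>k. 0) l = 0"
  by (simp add: diff_map_def)

text \<open>All coordinates \<open>l\<close> are tested, also those beyond the rank, where
  \<open>diff_map\<close> is zero; this agrees with \<open>tor_cycles\<close> as soon as
  \<open>0 \<in> I\<close>.\<close>

definition cycles_mod ::
    "'v set \<Rightarrow> ('v, 'k::field) free_cplx \<Rightarrow> ('v, 'k) mpoly set \<Rightarrow> nat \<Rightarrow> nat \<Rightarrow> nat
      \<Rightarrow> (nat \<Rightarrow> ('v, 'k) mpoly) set" where
  "cycles_mod V P I i t e =
     {x \<in> graded_shift V P i t e. \<forall>i'. i = Suc i' \<longrightarrow> (\<forall>l. diff_map P i' x l \<in> I)}"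

definition boundaries_mod ::
    "'v set \<Rightarrow> ('v, 'k::field) free_cplx \<Rightarrow> ('v, 'k) mpoly set \<Rightarrow> nat \<Rightarrow> nat \<Rightarrow> nat
      \<Rightarrow> (nat \<Rightarrow> ('v, 'k) mpoly) set" where
  "boundaries_mod V P I i t e =
     {x \<in> graded_shift V P i t e. \<exists>y \<in> graded_shift V P (Suc i) t e. \<forall>k. x k - diff_map P i y k \<in> I}"

lemma tor_cycles_eq: "0 \<in> I \<Longrightarrow> tor_cycles V I P i e = cycles_mod V P I i 0 e"
  unfolding tor_cycles_def cycles_mod_def graded_shift_0 diff_map_def by auto

lemma tor_boundaries_eq: "0 \<in> I \<Longrightarrow> tor_boundaries V I P i e = boundaries_mod V P I i 0 e"
  unfolding tor_boundaries_def boundaries_mod_def graded_shift_0 diff_map_def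
  by (auto simp: graded_part_def free_mod_def not_less)

text \<open>What the diagram chases need of a resolution: homogeneous matrices and vanishing
  composites. Exactness of the resolution of the residue field enters only through
  \<open>tor_linear_vanishing\<close>.\<close>

locale graded_free_complex =
  fixes V :: "'v set" and P :: "('v, 'k::field) free_cplx"
  assumes finite_V: "finite V"
    and mat_graded: "k < rk P (Suc i) \<Longrightarrow> l < rk P i \<Longrightarrow> mat P i k l \<in>
      pspan {m. Poly_Mapping.keys m \<subseteq> V \<and> mono_deg m + sh P i l = sh P (Suc i) k}"
    and diff_diff: "x \<in> free_mod V (rk P (Suc (Suc i))) \<Longrightarrow> diff_map P i (diff_map P (Suc i) x) l = 0"
begin

lemma mat_poly_ring: "k < rk P (Suc i) \<Longrightarrow> l < rk P i \<Longrightarrow> mat P i k l \<in> poly_ring V"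
  unfolding poly_ring_eq_pspan by (rule pspan_mono[OF mat_graded]) auto

lemma diff_graded_shift:
  assumes "x \<in> graded_shift V P (Suc i) t e"
  shows "diff_map P i x \<in> graded_shift V P i t e"
proof -
  have "x k * mat P i k l \<in> pspan {m. Poly_Mapping.keys m \<subseteq> V \<and> mono_deg m + sh P i l + t = e}"
    if "k < rk P (Suc i)" "l < rk P i" for k l
  proof (rule pspan_mult[OF _ mat_graded[OF that]])
    show "x k \<in> pspan {m. Poly_Mapping.keys m \<subseteq> V \<and> mono_deg m + sh P (Suc i) k + t = e}"
      using assms that(1) by (simp add: graded_shift_def)
  qed (auto simp: keys_monomial_add mono_deg_add)
  then show ?thesis
    unfolding graded_shift_def diff_map_def by (auto intro: pspan_sum)
qed

lemma diff_supp_ideal: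
  assumes "mono N" "\<And>k. x k \<in> supp_ideal V N"
  shows "diff_map P i x l \<in> supp_ideal V N"
proof -
  have "x k * mat P i k l \<in> supp_ideal V N" if "k < rk P (Suc i)" "l < rk P i" for k
    using assms mat_poly_ring[OF that] by (intro supp_ideal_mult)
  then show ?thesis
    unfolding diff_map_def supp_ideal_def by (auto intro: pspan_sum)
qed

lemma boundaries_subset_cycles:
  assumes "mono N"
  shows "boundaries_mod V P (supp_ideal V N) i t e \<subseteq> cycles_mod V P (supp_ideal V N) i t e"
proof
  fix x assume "x \<in> boundaries_mod V P (supp_ideal V N) i t e"
  then obtain y where x: "x \<in> graded_shift V P i t e"
      and y: "y \<in> graded_shift V P (Suc i) t e" "\<And>k. x k - diff_map P i y k \<in> supp_ideal V N"
    unfolding boundaries_mod_def by blast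
  have "diff_map P i' x l \<in> supp_ideal V N" if i: "i = Suc i'" for i' l
  proof -
    have "diff_map P i' (\<lambda>k. x k - diff_map P i y k) l \<in> supp_ideal V N"
      by (rule diff_supp_ideal[OF assms y(2)])
    moreover have "diff_map P i' (diff_map P i y) l = 0"
      using diff_diff graded_shift_free_mod[OF y(1)] unfolding i by blast
    ultimately show ?thesis by (simp add: diff_map_diff)
  qed
  then show "x \<in> cycles_mod V P (supp_ideal V N) i t e"
    unfolding cycles_mod_def using x by blast
qed

text \<open>For \<open>I = supp_ideal V N\<close>, the ideals in the next two lemmas are \<open>I\<close>, \<open>I + (x\<^sub>F)\<close> and
  \<open>I : x\<^sub>F\<close>. They are chases in the long exact Tor sequence of
  \<open>0 \<rightarrow> (S/(I : x\<^sub>F))(-|F|) \<rightarrow> S/I \<rightarrow> S/(I + (x\<^sub>F)) \<rightarrow> 0\<close>: if the connecting map (respectively the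
  map out of the first term) vanishes, then \<open>Tor(S/I) \<rightarrow> Tor(S/(I + (x\<^sub>F)))\<close> is surjective
  (respectively injective).\<close>

lemma cycle_lift:
  assumes N: "mono N" and F: "finite F" "F \<subseteq> V"
    and van: "\<And>i'. i = Suc i' \<Longrightarrow>
      cycles_mod V P (supp_ideal V (\<lambda>X. N (F \<union> X))) i' (t + card F) e
        \<subseteq> boundaries_mod V P (supp_ideal V (\<lambda>X. N (F \<union> X))) i' (t + card F) e"
    and x: "x \<in> cycles_mod V P (supp_ideal V (\<lambda>X. N X \<or> F \<subseteq> X)) i t e"
  obtains y where "y \<in> graded_shift V P i (t + card F) e"
    "(\<lambda>k. x k - Poly_Mapping.single (sqfree F) 1 * y k) \<in> cycles_mod V P (supp_ideal V N) i t e"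
proof (cases i)
  case 0
  show ?thesis
    by (rule that[of "\<lambda>k. 0"]) (use x 0 in \<open>auto simp: cycles_mod_def graded_shift_zero\<close>)
next
  case (Suc i')
  let ?f = "Poly_Mapping.single (sqfree F) 1 :: ('v, 'k) mpoly"
  let ?A = "supp_ideal V (\<lambda>X. N (F \<union> X)) :: ('v, 'k) mpoly set"
  have xg: "x \<in> graded_shift V P (Suc i') t e" using x Suc by (simp add: cycles_mod_def)
  have dx: "diff_map P i' x l \<in> supp_ideal V (\<lambda>X. N X \<or> F \<subseteq> X)" for l
    using x Suc by (simp add: cycles_mod_def)
  \<comment> \<open>\<open>z\<close> represents the image of the class of \<open>x\<close> under the
    connecting map.\<close>
  obtain w z where wz: "\<And>k. diff_map P i' x k = w k + ?f * z k" "\<And>k. w k \<in> supp_ideal V N"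
      "w \<in> graded_shift V P i' t e" "z \<in> graded_shift V P i' (t + card F) e"
    using graded_shift_split[OF diff_graded_shift[OF xg] dx F(1)] by blast
  \<comment> \<open>Applying the differential to \<open>dx = w + x\<^sub>F z\<close> shows that
    \<open>x\<^sub>F dz = - dw\<close> has entries in \<open>I\<close>, so \<open>dz\<close> has
    entries in the colon ideal.\<close>
  have "z \<in> cycles_mod V P ?A i' (t + card F) e"
  proof -
    have "diff_map P i'' z l \<in> ?A" if i': "i' = Suc i''" for i'' l
    proof -
      have "diff_map P i'' (\<lambda>k. w k + ?f * z k) l = 0"
        using diff_diff[OF graded_shift_free_mod[OF xg, unfolded i'], of l] wz(1) i'
        by (metis (no_types, lifting) ext)
      then have "?f * diff_map P i'' z l = - diff_map P i'' w l"
        by (simp add: diff_map_add diff_map_mult add_eq_0_iff)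
      moreover have "- diff_map P i'' w l \<in> supp_ideal V N"
        using diff_supp_ideal[OF N wz(2)] unfolding supp_ideal_def by (rule pspan_uminus)
      ultimately show ?thesis using supp_ideal_colon F(1) by metis
    qed
    then show ?thesis using wz(4) by (simp add: cycles_mod_def)
  qed
  then obtain y where y: "y \<in> graded_shift V P (Suc i') (t + card F) e"
      "\<And>k. z k - diff_map P i' y k \<in> ?A"
    using van[OF Suc] unfolding boundaries_mod_def by blast
  \<comment> \<open>As \<open>z - dy\<close> has entries in the colon ideal,
    \<open>x\<^sub>F (z - dy)\<close> has entries in \<open>I\<close>; subtracting
    \<open>x\<^sub>F y\<close> from \<open>x\<close> therefore repairs the cycle condition.\<close>
  have "diff_map P i' (\<lambda>k. x k - ?f * y k) l \<in> supp_ideal V N" for l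
  proof -
    have "diff_map P i' (\<lambda>k. x k - ?f * y k) l = w l + ?f * (z l - diff_map P i' y l)"
      by (simp add: diff_map_diff diff_map_mult wz(1) right_diff_distrib)
    moreover have "\<dots> \<in> supp_ideal V N"
      using wz(2) supp_ideal_colon_mult[OF y(2) F] unfolding supp_ideal_def by (intro pspan_add)
    ultimately show ?thesis by simp
  qed
  moreover have "(\<lambda>k. x k - ?f * y k) \<in> graded_shift V P (Suc i') t e"
    by (intro graded_shift_diff xg graded_shift_monomial_mult y(1) F)
  ultimately show ?thesis
    using that[of y] y(1) Suc by (simp add: cycles_mod_def)
qed

lemma boundary_lift:
  assumes N: "mono N" and F: "finite F" "F \<subseteq> V"
    and van: "cycles_mod V P (supp_ideal V (\<lambda>X. N (F \<union> X))) i (t + card F) e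
        \<subseteq> boundaries_mod V P (supp_ideal V (\<lambda>X. N (F \<union> X))) i (t + card F) e"
    and x: "x \<in> cycles_mod V P (supp_ideal V N) i t e"
      "x \<in> boundaries_mod V P (supp_ideal V (\<lambda>X. N X \<or> F \<subseteq> X)) i t e"
  shows "x \<in> boundaries_mod V P (supp_ideal V N) i t e"
proof -
  let ?f = "Poly_Mapping.single (sqfree F) 1 :: ('v, 'k) mpoly"
  let ?A = "supp_ideal V (\<lambda>X. N (F \<union> X)) :: ('v, 'k) mpoly set"
  obtain y where xg: "x \<in> graded_shift V P i t e" and yg: "y \<in> graded_shift V P (Suc i) t e"
      and y: "\<And>k. x k - diff_map P i y k \<in> supp_ideal V (\<lambda>X. N X \<or> F \<subseteq> X)"
    using x(2) unfolding boundaries_mod_def by blast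
  obtain w z where wz: "\<And>k. x k - diff_map P i y k = w k + ?f * z k" "\<And>k. w k \<in> supp_ideal V N"
      "w \<in> graded_shift V P i t e" "z \<in> graded_shift V P i (t + card F) e"
    using graded_shift_split[OF graded_shift_diff[OF xg diff_graded_shift[OF yg]] y F(1)] by blast
  \<comment> \<open>Here \<open>x\<^sub>F dz = dx - dw\<close>, and \<open>dx\<close> has entries in
    \<open>I\<close> because \<open>x\<close> is a cycle modulo \<open>I\<close>.\<close>
  have "z \<in> cycles_mod V P ?A i (t + card F) e"
  proof -
    have "diff_map P i' z l \<in> ?A" if i: "i = Suc i'" for i' l
    proof -
      have "diff_map P i' (\<lambda>k. w k + ?f * z k) l = diff_map P i' (\<lambda>k. x k - diff_map P i y k) l"
        by (simp add: wz(1))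
      also have "\<dots> = diff_map P i' x l"
        using diff_diff[OF graded_shift_free_mod[OF yg, unfolded i], of l]
        by (simp add: diff_map_diff i)
      finally have "?f * diff_map P i' z l = diff_map P i' x l - diff_map P i' w l"
        by (simp add: diff_map_add diff_map_mult eq_diff_eq add.commute)
      moreover have "diff_map P i' x l - diff_map P i' w l \<in> supp_ideal V N"
        using diff_supp_ideal[OF N wz(2)] x(1) i unfolding supp_ideal_def cycles_mod_def
        by (intro pspan_diff) auto
      ultimately show ?thesis using supp_ideal_colon F(1) by metis
    qed
    then show ?thesis using wz(4) by (simp add: cycles_mod_def)
  qed
  then obtain u where u: "u \<in> graded_shift V P (Suc i) (t + card F) e"
      "\<And>k. z k - diff_map P i u k \<in> ?A"
    using van unfolding boundaries_mod_def by blast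
  \<comment> \<open>Since \<open>z\<close> agrees with \<open>du\<close> modulo the colon ideal,
    adding \<open>x\<^sub>F u\<close> to \<open>y\<close> absorbs the error term
    \<open>x\<^sub>F z\<close> modulo \<open>I\<close>.\<close>
  let ?y = "\<lambda>k. y k + ?f * u k"
  have "x l - diff_map P i ?y l \<in> supp_ideal V N" for l
  proof -
    have "x l - diff_map P i ?y l = (x l - diff_map P i y l) - ?f * diff_map P i u l"
      by (simp add: diff_map_add diff_map_mult)
    also have "\<dots> = w l + ?f * (z l - diff_map P i u l)"
      by (simp add: wz(1) right_diff_distrib)
    moreover have "\<dots> \<in> supp_ideal V N"
      using wz(2) supp_ideal_colon_mult[OF u(2) F] unfolding supp_ideal_def by (intro pspan_add)
    ultimately show ?thesis by simp
  qed
  moreover have "?y \<in> graded_shift V P (Suc i) t e"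
    by (intro graded_shift_add yg graded_shift_monomial_mult u(1) F)
  ultimately show ?thesis
    unfolding boundaries_mod_def using xg by blast
qed

end

section \<open>Exactness of resolutions and homogeneous preimages\<close>

lemma poly_ring_closed:
  "0 \<in> poly_ring V"
  "p \<in> poly_ring V \<Longrightarrow> q \<in> poly_ring V \<Longrightarrow> p + q \<in> poly_ring V"
  "p \<in> poly_ring V \<Longrightarrow> - p \<in> poly_ring V"
  "p \<in> poly_ring V \<Longrightarrow> q \<in> poly_ring V \<Longrightarrow> p * q \<in> poly_ring V"
  unfolding poly_ring_eq_pspan
  by (simp_all add: pspan_add pspan_uminus) (erule (1) pspan_mult, simp add: keys_monomial_add)

lemma poly_ring_sum: "(\<And>i. i \<in> S \<Longrightarrow> f i \<in> poly_ring V) \<Longrightarrow> sum f S \<in> poly_ring V"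
  unfolding poly_ring_eq_pspan by (rule pspan_sum)

lemma aug_map_add: "aug_map P (\<lambda>k. x k + y k) = aug_map P x + aug_map P y"
  by (simp add: aug_map_def sum.distrib distrib_right)

lemma aug_map_diff: "aug_map P (\<lambda>k. x k - y k) = aug_map P x - aug_map P y"
  by (simp add: aug_map_def sum_subtractf left_diff_distrib)

lemma aug_map_mult: "aug_map P (\<lambda>k. c * x k) = c * aug_map P x"
  by (simp add: aug_map_def sum_distrib_left mult.assoc)

lemma free_mod_diff:
  "x \<in> free_mod V r \<Longrightarrow> y \<in> free_mod V r \<Longrightarrow> (\<lambda>k. x k - y k) \<in> free_mod V r"
  by (simp add: free_mod_def poly_ring_eq_pspan pspan_diff)

lemma free_mod_add:
  "x \<in> free_mod V r \<Longrightarrow> y \<in> free_mod V r \<Longrightarrow> (\<lambda>k. x k + y k) \<in> free_mod V r"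
  by (simp add: free_mod_def poly_ring_eq_pspan pspan_add)

lemma free_mod_uminus: "x \<in> free_mod V r \<Longrightarrow> (\<lambda>k. - x k) \<in> free_mod V r"
  by (simp add: free_mod_def poly_ring_eq_pspan pspan_uminus)

lemma free_mod_mult: "c \<in> poly_ring V \<Longrightarrow> x \<in> free_mod V r \<Longrightarrow> (\<lambda>k. c * x k) \<in> free_mod V r"
  by (simp add: free_mod_def poly_ring_closed)

text \<open>Serves both the vanishing argument, where \<open>A\<close> is the irrelevant ideal, and
  the cone construction, where \<open>A\<close> is generated by the variables treated so
  far.\<close>

locale resolution =
  fixes V :: "'v set" and A :: "('v, 'k::field) mpoly set" and P :: "('v, 'k) free_cplx"
  assumes graded_free_resolution: "graded_free_resolution V A P"
begin

lemmas resolution_conds = graded_free_resolution[unfolded graded_free_resolution_def]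
lemmas mat_degrees = resolution_conds[THEN conjunct1]
lemmas aug_degrees = resolution_conds[THEN conjunct2, THEN conjunct1]
lemmas exact_pos = resolution_conds[THEN conjunct2, THEN conjunct2, THEN conjunct2]

lemma mat_graded:
  assumes "k < rk P (Suc i)" "l < rk P i"
  shows "mat P i k l \<in> pspan {m. Poly_Mapping.keys m \<subseteq> V \<and> mono_deg m + sh P i l = sh P (Suc i) k}"
  using mat_degrees[THEN spec, THEN spec, THEN mp, OF assms(1), THEN spec, THEN mp, OF assms(2)]
  unfolding pspan_def poly_ring_def by blast

lemma aug_graded:
  "k < rk P 0 \<Longrightarrow> aug P k \<in> pspan {m. Poly_Mapping.keys m \<subseteq> V \<and> mono_deg m = sh P 0 k}"
  using aug_degrees[THEN spec, THEN mp] unfolding pspan_def poly_ring_def by blast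

lemma diff_free_mod: "x \<in> free_mod V (rk P (Suc i)) \<Longrightarrow> diff_map P i x \<in> free_mod V (rk P i)"
  using mat_degrees by (auto simp: free_mod_def diff_map_def intro!: poly_ring_sum poly_ring_closed)

lemma aug_poly_ring: "x \<in> free_mod V (rk P 0) \<Longrightarrow> aug_map P x \<in> poly_ring V"
  using aug_degrees by (auto simp: free_mod_def aug_map_def intro!: poly_ring_sum poly_ring_closed)

lemma aug_surj: "s \<in> poly_ring V \<Longrightarrow> \<exists>x\<in>free_mod V (rk P 0). s - aug_map P x \<in> A"
  using resolution_conds[THEN conjunct2, THEN conjunct2, THEN conjunct1] by blast

lemma exact_0: "{x \<in> free_mod V (rk P 0). aug_map P x \<in> A} = diff_map P 0 ` free_mod V (rk P 1)"
  using exact_pos[THEN conjunct1] .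

lemma exact_Suc:
  "{x \<in> free_mod V (rk P (Suc i)). diff_map P i x = 0} = diff_map P (Suc i) ` free_mod V (rk P (Suc (Suc i)))"
  using exact_pos[THEN conjunct2] by blast

lemma aug_diff: "x \<in> free_mod V (rk P 1) \<Longrightarrow> aug_map P (diff_map P 0 x) \<in> A"
  using exact_0 by blast

lemma diff_diff: "x \<in> free_mod V (rk P (Suc (Suc i))) \<Longrightarrow> diff_map P i (diff_map P (Suc i) x) l = 0"
proof -
  assume "x \<in> free_mod V (rk P (Suc (Suc i)))"
  then have "diff_map P i (diff_map P (Suc i) x) = 0" using exact_Suc[of i] by blast
  then show ?thesis by simp
qed

lemma preimage_0:
  assumes "x \<in> free_mod V (rk P 0)" "aug_map P x \<in> A"
  obtains y where "y \<in> free_mod V (rk P 1)" "\<And>l. x l = diff_map P 0 y l"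
proof -
  have "x \<in> diff_map P 0 ` free_mod V (rk P 1)"
    unfolding exact_0[symmetric] using assms by simp
  then obtain y where "x = diff_map P 0 y" "y \<in> free_mod V (rk P 1)" by (rule imageE)
  then show ?thesis by (intro that[of y]) simp_all
qed

lemma preimage_Suc:
  assumes "x \<in> free_mod V (rk P (Suc i))" "\<And>l. diff_map P i x l = 0"
  obtains y where "y \<in> free_mod V (rk P (Suc (Suc i)))" "\<And>l. x l = diff_map P (Suc i) y l"
proof -
  have "x \<in> diff_map P (Suc i) ` free_mod V (rk P (Suc (Suc i)))"
    unfolding exact_Suc[symmetric] using assms by (simp add: fun_eq_iff)
  then obtain y where "x = diff_map P (Suc i) y" "y \<in> free_mod V (rk P (Suc (Suc i)))"
    by (rule imageE)
  then show ?thesis by (intro that[of y]) simp_all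
qed

end

context graded_free_complex
begin

text \<open>Exactness yields a preimage without control of degrees. Since the differential preserves
  degree, the component of \<open>y\<close> in the degree of \<open>x\<close> is already a
  preimage.\<close>

lemma homogeneous_preimage:
  assumes x: "x \<in> graded_shift V P i t e" and y: "y \<in> free_mod V (rk P (Suc i))"
    and xy: "\<And>l. x l = diff_map P i y l"
  obtains z where "z \<in> graded_shift V P (Suc i) t e" "\<And>l. x l = diff_map P i z l"
proof -
  define H where "H j k = {m. Poly_Mapping.keys m \<subseteq> V \<and> mono_deg m + sh P j k + t = e}" for j k
  define H' where "H' j k = {m. Poly_Mapping.keys m \<subseteq> V \<and> mono_deg m + sh P j k + t \<noteq> e}" for j k
  have ex: "\<exists>q. q \<in> pspan (H (Suc i) k) \<and> y k - q \<in> pspan (H' (Suc i) k)"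
    if "k < rk P (Suc i)" for k
  proof -
    have "y k \<in> pspan (H (Suc i) k \<union> H' (Suc i) k)"
      using y that by (auto simp: free_mod_def poly_ring_eq_pspan H_def H'_def elim: pspan_mono)
    then obtain q r where "y k = q + r" "q \<in> pspan (H (Suc i) k)" "r \<in> pspan (H' (Suc i) k)"
      by (rule pspan_split)
    then show ?thesis by (intro exI[of _ q]) simp
  qed
  define z where "z k = (if k < rk P (Suc i)
      then SOME q. q \<in> pspan (H (Suc i) k) \<and> y k - q \<in> pspan (H' (Suc i) k) else 0)" for k
  have z: "z k \<in> pspan (H (Suc i) k)" "y k - z k \<in> pspan (H' (Suc i) k)" if "k < rk P (Suc i)" for k
    using someI_ex[OF ex[OF that]] that by (simp_all add: z_def)
  have zg: "z \<in> graded_shift V P (Suc i) t e"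
    using z(1) by (auto simp: graded_shift_def z_def H_def)
  have "x l = diff_map P i z l" for l
  proof (cases "l < rk P i")
    case True
    have "(y k - z k) * mat P i k l \<in> pspan (H' i l)" if "k < rk P (Suc i)" for k
      using z(2)[OF that] mat_graded[OF that True]
      by (rule pspan_mult) (auto simp: H'_def keys_monomial_add mono_deg_add)
    then have "diff_map P i (\<lambda>k. y k - z k) l \<in> pspan (H' i l)"
      using True by (auto simp: diff_map_def intro: pspan_sum)
    then have "x l - diff_map P i z l \<in> pspan (H' i l)"
      by (simp add: diff_map_diff xy)
    moreover have "x l - diff_map P i z l \<in> pspan (H i l)"
      using x diff_graded_shift[OF zg] True by (auto simp: graded_shift_def H_def intro: pspan_diff)
    \<comment> \<open>The difference involves only monomials that have the prescribed degree and do
      not have it.\<close>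
    ultimately have "x l - diff_map P i z l = 0"
      by (rule pspan_disjoint_eq_0) (auto simp: H_def H'_def)
    then show ?thesis by simp
  qed (simp add: xy diff_map_def)
  then show ?thesis using that zg by blast
qed

end

section \<open>Vanishing of Tor off the linear strand\<close>

lemma mono_meets: "mono (\<lambda>X. X \<inter> W \<noteq> {})"
  by (rule monoI) (auto simp: le_bool_def)

lemma graded_free_complex_of_resolution:
  assumes "finite V" "graded_free_resolution V A P"
  shows "graded_free_complex V P"
proof -
  interpret resolution V A P by unfold_locales fact
  show ?thesis by unfold_locales (use assms mat_graded diff_diff in auto)
qed

text \<open>\<open>Tor\<^sub>i(S/(x\<^sub>w | w \<in> W), \<F>)\<close> is concentrated in internal degree \<open>i\<close>.\<close>

lemma tor_linear_vanishing:
  fixes P :: "('v, 'k::field) free_cplx"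
  assumes "finite V" and res: "graded_free_resolution V (irrelevant_ideal V) P"
    and "W \<subseteq> V" "e \<noteq> i + t"
  shows "cycles_mod V P (supp_ideal V (\<lambda>X. X \<inter> W \<noteq> {})) i t e
    \<subseteq> boundaries_mod V P (supp_ideal V (\<lambda>X. X \<inter> W \<noteq> {})) i t e"
  using finite_subset[OF assms(3,1)] assms(3,4)
\<comment> \<open>The induction hypothesis is used at \<open>(i, t)\<close> and at
  \<open>(i - 1, t + 1)\<close>; both have the same sum, so \<open>e \<noteq> i + t\<close> is
  inherited.\<close>
proof (induction W arbitrary: i t rule: finite_induct)
  case empty
  interpret graded_free_complex V P
    by (rule graded_free_complex_of_resolution) fact+
  interpret resolution V "irrelevant_ideal V" P by unfold_locales fact
  \<comment> \<open>For empty \<open>W\<close> only the homology of \<open>P\<close> itself is at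
    stake. Exactness settles positive degrees directly; in degree 0 the augmentation must first be
    shown to land in the irrelevant ideal.\<close>
  have zero: "supp_ideal V (\<lambda>X. X \<inter> {} \<noteq> {}) = {0 :: ('v, 'k) mpoly}"
    by (auto simp: supp_ideal_def pspan_def)
  show ?case
  proof
    fix x :: "nat \<Rightarrow> ('v, 'k) mpoly"
    assume "x \<in> cycles_mod V P (supp_ideal V (\<lambda>X. X \<inter> {} \<noteq> {})) i t e"
    then have x: "x \<in> graded_shift V P i t e" "\<And>i' l. i = Suc i' \<Longrightarrow> diff_map P i' x l = 0"
      unfolding cycles_mod_def zero by auto
    obtain y where y: "y \<in> free_mod V (rk P (Suc i))" "\<And>l. x l = diff_map P i y l"
    proof (cases i)
      case 0
      have "x k * aug P k \<in> irrelevant_ideal V" if "k < rk P 0" for k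
        unfolding irrelevant_ideal_eq[OF assms(1)] supp_ideal_def
      proof (rule pspan_mult[OF _ aug_graded[OF that]])
        show "x k \<in> pspan {m. Poly_Mapping.keys m \<subseteq> V \<and> mono_deg m + sh P 0 k + t = e}"
          using x(1) that 0 by (simp add: graded_shift_def)
        fix m m'
        assume m: "m \<in> {m. Poly_Mapping.keys m \<subseteq> V \<and> mono_deg m + sh P 0 k + t = e}"
          and m': "m' \<in> {m. Poly_Mapping.keys m \<subseteq> V \<and> mono_deg m = sh P 0 k}"
        \<comment> \<open>The degrees add up to \<open>e - t\<close>, which is nonzero for
          \<open>i = 0\<close>, so there is no constant term.\<close>
        then have "mono_deg (m + m') \<noteq> 0" using empty.prems 0 by (auto simp: mono_deg_add)
        then have "Poly_Mapping.keys (m + m') \<noteq> {}" by (auto simp only: mono_deg_def sum.empty)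
        moreover have "Poly_Mapping.keys (m + m') \<subseteq> V" using m m' by (simp add: keys_monomial_add)
        ultimately show "m + m' \<in> {m. Poly_Mapping.keys m \<subseteq> V \<and> Poly_Mapping.keys m \<inter> V \<noteq> {}}"
          by blast
      qed
      then have "aug_map P x \<in> irrelevant_ideal V"
        unfolding aug_map_def irrelevant_ideal_eq[OF assms(1)] supp_ideal_def
        by (intro pspan_sum) simp
      then show ?thesis
        using preimage_0[OF graded_shift_free_mod[OF x(1)[unfolded 0]]] that 0
        by (metis One_nat_def)
    next
      case (Suc i')
      then show ?thesis
        using preimage_Suc[OF graded_shift_free_mod[OF x(1)[unfolded Suc]] x(2)] that by blast
    qed
    obtain z where "z \<in> graded_shift V P (Suc i) t e" "\<And>l. x l = diff_map P i z l"
      using homogeneous_preimage[OF x(1) y] by blast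
    then show "x \<in> boundaries_mod V P (supp_ideal V (\<lambda>X. X \<inter> {} \<noteq> {})) i t e"
      unfolding boundaries_mod_def zero using x(1) by auto
  qed
next
  case (insert w W)
  interpret graded_free_complex V P
    by (rule graded_free_complex_of_resolution) fact+
  let ?N = "\<lambda>X. X \<inter> W \<noteq> {}"
  have J: "(\<lambda>X. X \<inter> insert w W \<noteq> {}) = (\<lambda>X. ?N X \<or> {w} \<subseteq> X)" by auto
  \<comment> \<open>As \<open>w \<notin> W\<close>, the variable \<open>x\<^sub>w\<close> is a
    nonzerodivisor modulo the smaller ideal, so taking the colon changes nothing.\<close>
  have A: "(\<lambda>X. ?N ({w} \<union> X)) = ?N" using insert.hyps by auto
  have F: "finite {w}" "{w} \<subseteq> V" using insert.prems by auto
  show ?case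
  proof
    fix x :: "nat \<Rightarrow> ('v, 'k) mpoly"
    assume x: "x \<in> cycles_mod V P (supp_ideal V (\<lambda>X. X \<inter> insert w W \<noteq> {})) i t e"
    obtain y where y: "y \<in> graded_shift V P i (t + card {w}) e"
      "(\<lambda>k. x k - Poly_Mapping.single (sqfree {w}) 1 * y k) \<in> cycles_mod V P (supp_ideal V ?N) i t e"
    proof (rule cycle_lift[OF mono_meets F _ x[unfolded J]])
      fix i' assume i': "i = Suc i'"
      show "cycles_mod V P (supp_ideal V (\<lambda>X. ?N ({w} \<union> X))) i' (t + card {w}) e
        \<subseteq> boundaries_mod V P (supp_ideal V (\<lambda>X. ?N ({w} \<union> X))) i' (t + card {w}) e"
        unfolding A by (rule insert.IH) (use insert.prems i' in auto)
    qed
    moreover have "cycles_mod V P (supp_ideal V ?N) i t e \<subseteq> boundaries_mod V P (supp_ideal V ?N) i t e"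
      by (rule insert.IH) (use insert.prems in auto)
    ultimately obtain u where u: "u \<in> graded_shift V P (Suc i) t e"
        "\<And>k. x k - Poly_Mapping.single (sqfree {w}) 1 * y k - diff_map P i u k \<in> supp_ideal V ?N"
      unfolding boundaries_mod_def by blast
    \<comment> \<open>The correction \<open>x\<^sub>w y\<close> has entries in the larger ideal, so
      a primitive of \<open>x - x\<^sub>w y\<close> is also one of \<open>x\<close> there.\<close>
    have "x k - diff_map P i u k \<in> supp_ideal V (\<lambda>X. X \<inter> insert w W \<noteq> {})" for k
    proof -
      have "y k \<in> poly_ring V"
        using graded_shift_free_mod[OF y(1)] by (cases "k < rk P i") (auto simp: free_mod_def poly_ring_closed)
      then have "Poly_Mapping.single (sqfree {w}) 1 * y k \<in> supp_ideal V (\<lambda>X. X \<inter> insert w W \<noteq> {})"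
        using F by (intro supp_ideal_mult mono_meets) (auto simp: supp_ideal_def pspan_def keys_sqfree)
      moreover have "x k - Poly_Mapping.single (sqfree {w}) 1 * y k - diff_map P i u k
          \<in> supp_ideal V (\<lambda>X. X \<inter> insert w W \<noteq> {})"
        using u(2)[of k] unfolding supp_ideal_def by (rule pspan_mono) auto
      ultimately have "Poly_Mapping.single (sqfree {w}) 1 * y k
          + (x k - Poly_Mapping.single (sqfree {w}) 1 * y k - diff_map P i u k)
          \<in> supp_ideal V (\<lambda>X. X \<inter> insert w W \<noteq> {})"
        unfolding supp_ideal_def by (rule pspan_add)
      then show ?thesis by simp
    qed
    then show "x \<in> boundaries_mod V P (supp_ideal V (\<lambda>X. X \<inter> insert w W \<noteq> {})) i t e"
      unfolding boundaries_mod_def using x u(1) by (auto simp: cycles_mod_def)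
  qed
qed


section \<open>Mapping cones and the existence of a resolution\<close>

definition join :: "nat \<Rightarrow> (nat \<Rightarrow> 'a) \<Rightarrow> (nat \<Rightarrow> 'a) \<Rightarrow> nat \<Rightarrow> 'a" where
  "join r x z = (\<lambda>k. if k < r then x k else z (k - r))"

lemma sum_lessThan_add:
  "sum f {..<a + b} = sum f {..<a} + (\<Sum>k<b. f (a + k) :: 'a::comm_monoid_add)" for a b :: nat
  by (induction b) (simp_all add: add.assoc)

lemma sum_join:
  "(\<Sum>k<a + b. f (join a x z k) k) = (\<Sum>k<a. f (x k) k) + (\<Sum>k<b. f (z k) (a + k) :: 'a::comm_monoid_add)"
  by (simp add: sum_lessThan_add join_def)

lemma join_free_mod:
  "x \<in> free_mod V a \<Longrightarrow> z \<in> free_mod V b \<Longrightarrow> join a x z \<in> free_mod V (a + b)"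
  by (auto simp: free_mod_def join_def)

lemma free_mod_joinE:
  assumes "u \<in> free_mod V (a + b)"
  obtains x z where "u = join a x z" "x \<in> free_mod V a" "z \<in> free_mod V b"
proof
  show "u = join a (\<lambda>k. if k < a then u k else 0) (\<lambda>k. u (a + k))"
    by (auto simp: join_def)
  show "(\<lambda>k. if k < a then u k else 0) \<in> free_mod V a" "(\<lambda>k. u (a + k)) \<in> free_mod V b"
    using assms by (auto simp: free_mod_def)
qed

text \<open>The mapping cone of multiplication by a linear form \<open>f\<close> on \<open>P\<close>. In degree \<open>i\<close> the basis of
  \<open>P\<^sub>i\<close> comes first, followed by that of \<open>P\<^sub>i\<^sub>-\<^sub>1(-1)\<close>.\<close>

definition cone :: "('v, 'k::field) mpoly \<Rightarrow> ('v, 'k) free_cplx \<Rightarrow> ('v, 'k) free_cplx" where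
  "cone f P = \<lparr>
     rk = (\<lambda>i. case i of 0 \<Rightarrow> rk P 0 | Suc j \<Rightarrow> rk P (Suc j) + rk P j),
     sh = (\<lambda>i k. if k < rk P i then sh P i k else Suc (sh P (i - 1) (k - rk P i))),
     mat = (\<lambda>i k l. if k < rk P (Suc i) then (if l < rk P i then mat P i k l else 0)
        else if l < rk P i then (if l = k - rk P (Suc i) then f else 0)
        else - mat P (i - 1) (k - rk P (Suc i)) (l - rk P i)),
     aug = aug P\<rparr>"

lemma cone_rk [simp]: "rk (cone f P) 0 = rk P 0" "rk (cone f P) (Suc i) = rk P (Suc i) + rk P i"
  by (simp_all add: cone_def)

lemma cone_aug_map [simp]: "aug_map (cone f P) = aug_map P"
  by (simp add: fun_eq_iff aug_map_def) (simp add: cone_def)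

text \<open>This and the next three lemmas compute the cone differential \<open>(x, z)\<close> to
  \<open>(dx + f z, - dz)\<close>, whose sign makes its square zero. In degree 0 the target has no
  second block.\<close>

lemma diff_cone_low:
  assumes "l < rk P i" "z \<in> free_mod V (rk P i)"
  shows "diff_map (cone f P) i (join (rk P (Suc i)) x z) l = diff_map P i x l + f * z l"
proof -
  have "l < rk (cone f P) i" using assms(1) by (cases i) simp_all
  then have "diff_map (cone f P) i (join (rk P (Suc i)) x z) l
      = (\<Sum>k<rk P (Suc i). x k * mat (cone f P) i k l)
        + (\<Sum>k<rk P i. z k * mat (cone f P) i (rk P (Suc i) + k) l)"
    unfolding diff_map_def cone_rk sum_join[of "\<lambda>y k. y * mat (cone f P) i k l"] by simp
  also have "(\<Sum>k<rk P (Suc i). x k * mat (cone f P) i k l) = diff_map P i x l"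
    using assms(1) by (simp add: diff_map_def cone_def)
  also have "(\<Sum>k<rk P i. z k * mat (cone f P) i (rk P (Suc i) + k) l)
      = (\<Sum>k<rk P i. if l = k then z k * f else 0)"
    using assms(1) by (intro sum.cong) (auto simp: cone_def)
  also have "\<dots> = f * z l" using assms(1) by (simp add: mult.commute)
  finally show ?thesis .
qed

lemma diff_cone_high:
  assumes "rk P (Suc i) \<le> l"
  shows "diff_map (cone f P) (Suc i) (join (rk P (Suc (Suc i))) x z) l
    = - diff_map P i z (l - rk P (Suc i))"
proof (cases "l < rk (cone f P) (Suc i)")
  case True
  then have "diff_map (cone f P) (Suc i) (join (rk P (Suc (Suc i))) x z) l
      = (\<Sum>k<rk P (Suc (Suc i)). x k * mat (cone f P) (Suc i) k l)
        + (\<Sum>k<rk P (Suc i). z k * mat (cone f P) (Suc i) (rk P (Suc (Suc i)) + k) l)"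
    unfolding diff_map_def cone_rk(2)[of f P "Suc i"]
      sum_join[of "\<lambda>y k. y * mat (cone f P) (Suc i) k l"] by simp
  also have "(\<Sum>k<rk P (Suc (Suc i)). x k * mat (cone f P) (Suc i) k l) = 0"
    using assms by (intro sum.neutral) (simp add: cone_def)
  also have "(\<Sum>k<rk P (Suc i). z k * mat (cone f P) (Suc i) (rk P (Suc (Suc i)) + k) l)
      = (\<Sum>k<rk P (Suc i). - (z k * mat P i k (l - rk P (Suc i))))"
    using assms by (intro sum.cong) (auto simp: cone_def)
  also have "\<dots> = - diff_map P i z (l - rk P (Suc i))"
    using assms True by (simp add: diff_map_def sum_negf less_diff_conv2 add.commute)
  finally show ?thesis by simp
next
  case False
  then show ?thesis using assms by (simp add: diff_map_def)
qed

lemma diff_cone_0: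
  assumes "x \<in> free_mod V (rk P 1)" "z \<in> free_mod V (rk P 0)"
  shows "diff_map (cone f P) 0 (join (rk P (Suc 0)) x z) = (\<lambda>l. diff_map P 0 x l + f * z l)"
proof
  fix l
  show "diff_map (cone f P) 0 (join (rk P (Suc 0)) x z) l = diff_map P 0 x l + f * z l"
  proof (cases "l < rk P 0")
    case False
    then show ?thesis using assms(2) by (simp add: diff_map_def free_mod_def)
  qed (use diff_cone_low assms(2) in blast)
qed

lemma diff_cone_Suc:
  assumes "z \<in> free_mod V (rk P (Suc i))"
  shows "diff_map (cone f P) (Suc i) (join (rk P (Suc (Suc i))) x z)
    = join (rk P (Suc i)) (\<lambda>l. diff_map P (Suc i) x l + f * z l) (\<lambda>l. - diff_map P i z l)"
proof
  fix l
  show "diff_map (cone f P) (Suc i) (join (rk P (Suc (Suc i))) x z) l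
    = join (rk P (Suc i)) (\<lambda>l. diff_map P (Suc i) x l + f * z l) (\<lambda>l. - diff_map P i z l) l"
  proof (cases "l < rk P (Suc i)")
    case True
    then show ?thesis unfolding diff_cone_low[OF True assms] by (simp add: join_def)
  next
    case False
    then have "rk P (Suc i) \<le> l" by simp
    from diff_cone_high[OF this] show ?thesis using False by (simp add: join_def)
  qed
qed

lemma join_zero: "join r (\<lambda>k. 0) (\<lambda>k. 0) = 0"
  by (auto simp: join_def fun_eq_iff)

text \<open>The cone is an extension of \<open>P(-1)\<close>, moved up one homological degree, by
  \<open>P\<close>, with connecting map multiplication by \<open>f\<close> on \<open>S/A\<close>.
  This is injective with cokernel \<open>S/(A + (f))\<close>, so the cone resolves that
  quotient.\<close>

lemma cone_resolution:
  fixes P :: "('v, 'k::field) free_cplx"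
  assumes res: "graded_free_resolution V A P"
    and f: "f \<in> pspan {m. Poly_Mapping.keys m \<subseteq> V \<and> mono_deg m = 1}"
    and A: "\<And>p q. p \<in> A \<Longrightarrow> q \<in> A \<Longrightarrow> p + q \<in> A" "\<And>p. p \<in> A \<Longrightarrow> - p \<in> A" "0 \<in> A" "\<And>p. p \<in> A \<Longrightarrow> f * p \<in> A"
    and nonzerodivisor: "\<And>s. s \<in> poly_ring V \<Longrightarrow> f * s \<in> A \<Longrightarrow> s \<in> A"
    and A': "A' = {a + f * s | a s. a \<in> A \<and> s \<in> poly_ring V}"
  shows "graded_free_resolution V A' (cone f P)"
proof -
  interpret resolution V A P by unfold_locales fact
  have f_ring: "f \<in> poly_ring V"
    using f unfolding poly_ring_eq_pspan by (rule pspan_mono) auto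
  have A_sub: "A \<subseteq> A'"
    unfolding A'
  proof
    fix a assume "a \<in> A"
    moreover have "a = a + f * 0" by simp
    ultimately show "a \<in> {a + f * s | a s. a \<in> A \<and> s \<in> poly_ring V}"
      using poly_ring_closed(1)[of V] by blast
  qed
  have mats: "mat (cone f P) i k l \<in>
      pspan {m. Poly_Mapping.keys m \<subseteq> V \<and> mono_deg m + sh (cone f P) i l = sh (cone f P) (Suc i) k}"
    if k: "k < rk (cone f P) (Suc i)" and l: "l < rk (cone f P) i" for i k l
  proof -
    \<comment> \<open>The four blocks of the matrix. The block carrying \<open>- mat\<close> occurs
      only for \<open>i = Suc j\<close>, since degree 0 of the cone is just
      \<open>P\<^sub>0\<close>.\<close>
    consider "k < rk P (Suc i)" "l < rk P i" | "k < rk P (Suc i)" "rk P i \<le> l"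
      | "rk P (Suc i) \<le> k" "l < rk P i" | j where "i = Suc j" "rk P (Suc i) \<le> k" "rk P i \<le> l"
      using l by (cases i; cases "k < rk P (Suc i)"; cases "l < rk P i") (auto simp: not_less)
    then show ?thesis
    proof cases
      case 1
      then show ?thesis using mat_graded[of k i l] by (simp add: cone_def)
    next
      case 2
      then show ?thesis by (simp add: cone_def)
    next
      case 3
      then show ?thesis
        using pspan_mono[OF f, of "{m. Poly_Mapping.keys m \<subseteq> V \<and> mono_deg m + sh P i l = Suc (sh P i l)}"]
        by (auto simp: cone_def)
    next
      case 4
      then have "k - rk P (Suc i) < rk P (Suc j)" "l - rk P i < rk P j" using k l by auto
      then show ?thesis
        using mat_graded[of "k - rk P (Suc i)" j "l - rk P i"] 4 by (simp add: cone_def pspan_uminus)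
    qed
  qed
  have augs: "aug (cone f P) k \<in> pspan {m. Poly_Mapping.keys m \<subseteq> V \<and> mono_deg m = sh (cone f P) 0 k}"
    if "k < rk (cone f P) 0" for k
    using aug_graded[of k] that by (simp add: cone_def)
  have surj: "\<exists>x\<in>free_mod V (rk P 0). s - aug_map P x \<in> A'" if "s \<in> poly_ring V" for s
    using aug_surj[OF that] A_sub by blast
  have ex0: "u \<in> {x \<in> free_mod V (rk P 0). aug_map P x \<in> A'}
      \<longleftrightarrow> u \<in> diff_map (cone f P) 0 ` free_mod V (rk P (Suc 0) + rk P 0)" (is "?L \<longleftrightarrow> ?R") for u
  proof
    assume ?L
    then obtain a s where u: "u \<in> free_mod V (rk P 0)" "aug_map P u = a + f * s" "a \<in> A" "s \<in> poly_ring V"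
      unfolding A' by auto
    \<comment> \<open>Lifting \<open>s\<close> to \<open>z\<close> and subtracting
      \<open>f z\<close> from \<open>u\<close> brings the augmentation into \<open>A\<close>, where
      exactness of \<open>P\<close> applies.\<close>
    obtain z where z: "z \<in> free_mod V (rk P 0)" "s - aug_map P z \<in> A"
      using aug_surj[OF u(4)] by blast
    have "aug_map P (\<lambda>k. u k - f * z k) = a + f * (s - aug_map P z)"
      by (simp add: aug_map_diff aug_map_mult u(2) right_diff_distrib)
    moreover have "f * (s - aug_map P z) \<in> A" by (rule A(4)[OF z(2)])
    ultimately have "aug_map P (\<lambda>k. u k - f * z k) \<in> A" using A(1) u(3) by simp
    then obtain y where y: "y \<in> free_mod V (rk P 1)" "\<And>l. u l - f * z l = diff_map P 0 y l"
      using preimage_0[OF free_mod_diff[OF u(1) free_mod_mult[OF f_ring z(1)]]] by blast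
    have "u = diff_map (cone f P) 0 (join (rk P (Suc 0)) y z)"
      unfolding diff_cone_0[OF y(1) z(1)] using y(2) by (simp add: fun_eq_iff eq_diff_eq[symmetric] diff_eq_eq)
    then show ?R using y(1) z(1) join_free_mod by (metis One_nat_def image_eqI)
  next
    assume ?R
    then obtain w where w: "w \<in> free_mod V (rk P (Suc 0) + rk P 0)" "u = diff_map (cone f P) 0 w" by blast
    then obtain x z where xz: "w = join (rk P (Suc 0)) x z" "x \<in> free_mod V (rk P 1)" "z \<in> free_mod V (rk P 0)"
      using free_mod_joinE by (metis One_nat_def)
    have u: "u = (\<lambda>l. diff_map P 0 x l + f * z l)"
      unfolding w(2) xz(1) by (rule diff_cone_0[OF xz(2,3)])
    have "u \<in> free_mod V (rk P 0)"
      unfolding u using xz f_ring by (intro free_mod_add diff_free_mod free_mod_mult) simp_all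
    moreover have "aug_map P u \<in> A'"
      unfolding A' u aug_map_add aug_map_mult
      using aug_diff[OF xz(2)] aug_poly_ring[OF xz(3)] by blast
    ultimately show ?L by simp
  qed
  have exS: "u \<in> {x \<in> free_mod V (rk (cone f P) (Suc i)). diff_map (cone f P) i x = 0}
      \<longleftrightarrow> u \<in> diff_map (cone f P) (Suc i) ` free_mod V (rk P (Suc (Suc i)) + rk P (Suc i))"
    (is "?L \<longleftrightarrow> ?R") for u i
  proof
    assume ?L
    then have u: "u \<in> free_mod V (rk P (Suc i) + rk P i)" "\<And>l. diff_map (cone f P) i u l = 0"
      by (simp_all add: fun_eq_iff)
    obtain a b where ab: "u = join (rk P (Suc i)) a b" "a \<in> free_mod V (rk P (Suc i))"
        "b \<in> free_mod V (rk P i)"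
      using free_mod_joinE[OF u(1)] by blast
    have low: "diff_map P i a l + f * b l = 0" for l
    proof (cases "l < rk P i")
      case True
      then show ?thesis using diff_cone_low[OF True ab(3), of f a] u(2)[of l] ab(1) by simp
    next
      case False
      then show ?thesis using ab(3) by (simp add: diff_map_def free_mod_def)
    qed
    \<comment> \<open>For \<open>i > 0\<close> the second block says that \<open>b\<close> is a
      cycle. For \<open>i = 0\<close> that block is absent; instead \<open>f\<close> times the
      augmentation of \<open>b\<close> lies in \<open>A\<close>, and \<open>f\<close> is a
      nonzerodivisor modulo \<open>A\<close>.\<close>
    obtain y where y: "y \<in> free_mod V (rk P (Suc i))" "\<And>l. b l = diff_map P i y l"
    proof (cases i)
      case 0
      have "(\<lambda>l. f * b l) = (\<lambda>l. 0 - diff_map P i a l)"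
        using low by (simp add: fun_eq_iff eq_neg_iff_add_eq_0 add.commute)
      then have "f * aug_map P b = - aug_map P (diff_map P i a)"
        using aug_map_mult[of P f b] aug_map_diff[of P "\<lambda>_. 0" "diff_map P i a"]
        by (simp add: aug_map_def)
      moreover have "- aug_map P (diff_map P i a) \<in> A"
        using aug_diff[of a] ab(2) 0 A(2) by simp
      ultimately have "f * aug_map P b \<in> A" by simp
      moreover have b: "b \<in> free_mod V (rk P 0)" using ab(3) 0 by simp
      ultimately have "aug_map P b \<in> A" using nonzerodivisor aug_poly_ring by blast
      from preimage_0[OF b this] show ?thesis using that 0 by (metis One_nat_def)
    next
      case (Suc j)
      have b: "b \<in> free_mod V (rk P (Suc j))" using ab(3) Suc by simp
      have "diff_map P j b l = 0" for l
        using u(2)[of "rk P (Suc j) + l"] diff_cone_high[of P j "rk P (Suc j) + l" f a b] ab(1) Suc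
        by simp
      from preimage_Suc[OF b this] show ?thesis using that Suc by blast
    qed
    \<comment> \<open>The sign in the cone forces \<open>z = - y\<close>. Then
      \<open>d(a - f z) = da + f b = 0\<close>, so exactness of \<open>P\<close> supplies the
      remaining block \<open>x\<close>.\<close>
    let ?z = "\<lambda>l. - y l"
    have z: "?z \<in> free_mod V (rk P (Suc i))" by (rule free_mod_uminus[OF y(1)])
    have dz: "diff_map P i ?z l = - b l" for l
      using diff_map_mult[of P i "-1" y l] y(2)[of l] by simp
    have "(\<lambda>l. a l - f * ?z l) \<in> free_mod V (rk P (Suc i))"
      by (rule free_mod_diff[OF ab(2) free_mod_mult[OF f_ring z]])
    moreover have "diff_map P i (\<lambda>l. a l - f * ?z l) l = 0" for l
      unfolding diff_map_diff diff_map_mult dz using low[of l] by simp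
    ultimately obtain x where x: "x \<in> free_mod V (rk P (Suc (Suc i)))"
        "\<And>l. a l - f * ?z l = diff_map P (Suc i) x l"
      using preimage_Suc by blast
    have "a = (\<lambda>l. diff_map P (Suc i) x l + f * ?z l)" "b = (\<lambda>l. - diff_map P i ?z l)"
      unfolding x(2)[symmetric] dz by simp_all
    then have "u = diff_map (cone f P) (Suc i) (join (rk P (Suc (Suc i))) x ?z)"
      unfolding diff_cone_Suc[OF z] ab(1) by (rule arg_cong2)
    then show ?R using join_free_mod[OF x(1) z] by (rule image_eqI)
  next
    assume ?R
    then obtain w where w: "w \<in> free_mod V (rk P (Suc (Suc i)) + rk P (Suc i))"
        "u = diff_map (cone f P) (Suc i) w" by (rule imageE)
    obtain x z where xz: "w = join (rk P (Suc (Suc i))) x z" "x \<in> free_mod V (rk P (Suc (Suc i)))"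
        "z \<in> free_mod V (rk P (Suc i))"
      using free_mod_joinE[OF w(1)] by blast
    let ?a = "\<lambda>l. diff_map P (Suc i) x l + f * z l" and ?b = "\<lambda>l. - diff_map P i z l"
    have u: "u = join (rk P (Suc i)) ?a ?b"
      unfolding w(2) xz(1) by (rule diff_cone_Suc[OF xz(3)])
    have a: "?a \<in> free_mod V (rk P (Suc i))" and b: "?b \<in> free_mod V (rk P i)"
      using xz f_ring by (auto intro!: free_mod_add diff_free_mod free_mod_mult free_mod_uminus)
    have low: "diff_map P i ?a l + f * ?b l = 0" for l
      using diff_diff[OF xz(2)] by (simp add: diff_map_add diff_map_mult)
    have "diff_map (cone f P) i u = (\<lambda>l. 0)"
    proof (cases i)
      case 0
      show ?thesis
        using diff_cone_0[of ?a V P ?b f] a b low unfolding u 0 by simp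
    next
      case (Suc j)
      have "diff_map P j ?b l = 0" for l
        using diff_map_mult[of P j "-1" "diff_map P (Suc j) z" l] diff_diff[of z j l] xz(3) Suc by simp
      then have "diff_map (cone f P) (Suc j) u = join (rk P (Suc j)) (\<lambda>l. 0) (\<lambda>l. 0)"
        using diff_cone_Suc[of ?b V P j f ?a] b low unfolding u Suc by simp
      then show ?thesis using join_zero[of "rk P (Suc j)"] by (simp add: Suc zero_fun_def)
    qed
    moreover have "u \<in> free_mod V (rk P (Suc i) + rk P i)"
      unfolding u by (rule join_free_mod[OF a b])
    ultimately show ?L by (simp add: zero_fun_def)
  qed
  show ?thesis
    unfolding graded_free_resolution_def
  proof (intro conjI allI impI ballI)
    fix i k l assume "k < rk (cone f P) (Suc i)" "l < rk (cone f P) i"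
    note entry = mats[OF this]
    then show "mat (cone f P) i k l \<in> poly_ring V" by (auto simp: poly_ring_def pspan_def)
    fix m assume "m \<in> Poly_Mapping.keys (mat (cone f P) i k l)"
    with entry show "mono_deg m + sh (cone f P) i l = sh (cone f P) (Suc i) k"
      by (auto simp: pspan_def)
  next
    fix k assume "k < rk (cone f P) 0"
    note entry = augs[OF this]
    then show "aug (cone f P) k \<in> poly_ring V" by (auto simp: poly_ring_def pspan_def)
    fix m assume "m \<in> Poly_Mapping.keys (aug (cone f P) k)"
    with entry show "mono_deg m = sh (cone f P) 0 k" by (auto simp: pspan_def)
  next
    fix s :: "('v, 'k) mpoly" assume "s \<in> poly_ring V"
    from surj[OF this] show "\<exists>x\<in>free_mod V (rk (cone f P) 0). s - aug_map (cone f P) x \<in> A'"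
      by simp
  next
    show "{x \<in> free_mod V (rk (cone f P) 0). aug_map (cone f P) x \<in> A'}
        = diff_map (cone f P) 0 ` free_mod V (rk (cone f P) 1)"
      unfolding One_nat_def cone_rk cone_aug_map by (rule set_eqI, rule ex0)
  next
    fix i
    show "{x \<in> free_mod V (rk (cone f P) (Suc i)). diff_map (cone f P) i x = 0}
        = diff_map (cone f P) (Suc i) ` free_mod V (rk (cone f P) (Suc (Suc i)))"
      unfolding cone_rk(2)[of f P "Suc i"] by (rule set_eqI, rule exS)
  qed
qed

text \<open>Provides the description of the enlarged ideal that \<open>cone_resolution\<close>
  expects: a monomial meeting \<open>insert w W\<close> meets \<open>W\<close> or is divisible by
  \<open>x\<^sub>w\<close>.\<close>

lemma supp_ideal_meets_insert:
  assumes "w \<in> V"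
  shows "supp_ideal V (\<lambda>X. X \<inter> insert w W \<noteq> {})
    = {a + Poly_Mapping.single (sqfree {w}) 1 * s | a s.
        a \<in> supp_ideal V (\<lambda>X. X \<inter> W \<noteq> {}) \<and> s \<in> (poly_ring V :: ('v, 'k::field) mpoly set)}"
    (is "?L = ?R")
proof
  show "?L \<subseteq> ?R"
  proof
    fix p :: "('v, 'k) mpoly" assume "p \<in> ?L"
    then have "p \<in> pspan ({m. Poly_Mapping.keys m \<subseteq> V \<and> Poly_Mapping.keys m \<inter> W \<noteq> {}}
        \<union> {m. Poly_Mapping.keys m \<subseteq> V \<and> w \<in> Poly_Mapping.keys m})"
      unfolding supp_ideal_def by (rule pspan_mono) auto
    then obtain q r where qr: "p = q + r" "q \<in> supp_ideal V (\<lambda>X. X \<inter> W \<noteq> {})"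
        "r \<in> pspan {m. Poly_Mapping.keys m \<subseteq> V \<and> w \<in> Poly_Mapping.keys m}"
      unfolding supp_ideal_def by (rule pspan_split)
    obtain s where "r = Poly_Mapping.single (sqfree {w}) 1 * s" "s \<in> poly_ring V"
      unfolding poly_ring_eq_pspan
    proof (rule pspan_divide[OF qr(3)])
      fix m :: "'v \<Rightarrow>\<^sub>0 nat"
      assume m: "m \<in> {m. Poly_Mapping.keys m \<subseteq> V \<and> w \<in> Poly_Mapping.keys m}"
      then obtain n where "m = sqfree {w} + n" using sqfree_divides[of "{w}" m] by auto
      with m show "\<exists>n\<in>{m. Poly_Mapping.keys m \<subseteq> V}. m = sqfree {w} + n"
        by (intro bexI[of _ n]) (auto simp: keys_monomial_add)
    qed
    with qr show "p \<in> ?R" by blast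
  qed
next
  show "?R \<subseteq> ?L"
  proof
    fix p :: "('v, 'k) mpoly" assume "p \<in> ?R"
    then obtain a s where p: "p = a + Poly_Mapping.single (sqfree {w}) 1 * s"
        "a \<in> supp_ideal V (\<lambda>X. X \<inter> W \<noteq> {})" "s \<in> poly_ring V" by blast
    have "Poly_Mapping.single (sqfree {w}) 1 * s \<in> ?L"
      using p(3) assms by (intro supp_ideal_mult mono_meets) (auto simp: supp_ideal_def pspan_def keys_sqfree)
    moreover have "a \<in> ?L" using p(2) unfolding supp_ideal_def by (rule pspan_mono) auto
    ultimately show "p \<in> ?L" unfolding p(1) supp_ideal_def by (intro pspan_add)
  qed
qed

text \<open>One cone per variable, which builds the Koszul complex on the variables in
  \<open>W\<close>.\<close>

lemma resolution_exists:
  assumes "finite V" "W \<subseteq> V"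
  shows "\<exists>P. graded_free_resolution V (supp_ideal V (\<lambda>X. X \<inter> W \<noteq> {}) :: ('v, 'k::field) mpoly set) P"
  using finite_subset[OF assms(2,1)] assms(2)
proof (induction W rule: finite_induct)
  case empty
  \<comment> \<open>The ring \<open>S\<close> placed in homological degree 0, as a resolution of
    \<open>S/0\<close>.\<close>
  define P :: "('v, 'k) free_cplx" where
    "P = \<lparr>rk = (\<lambda>i. if i = 0 then 1 else 0), sh = (\<lambda>_ _. 0), mat = (\<lambda>_ _ _. 0), aug = (\<lambda>_. 1)\<rparr>"
  have zero: "supp_ideal V (\<lambda>X. X \<inter> {} \<noteq> {}) = {0 :: ('v, 'k) mpoly}"
    by (auto simp: supp_ideal_def pspan_def)
  have rk: "rk P 0 = 1" "rk P (Suc i) = 0" "rk P 1 = 0" for i by (simp_all add: P_def)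
  have free_mod_0: "free_mod V 0 = {0 :: nat \<Rightarrow> ('v, 'k) mpoly}"
    by (auto simp: free_mod_def fun_eq_iff)
  have diff: "diff_map P i x = 0" for i x
    by (simp add: diff_map_def fun_eq_iff rk)
  have aug: "aug_map P x = x 0" for x
    by (simp add: aug_map_def rk) (simp add: P_def)
  have "\<exists>x\<in>free_mod V (rk P 0). s - aug_map P x \<in> {0}" if "s \<in> poly_ring V" for s
    using that by (intro bexI[of _ "\<lambda>k. if k = 0 then s else 0"]) (auto simp: aug rk free_mod_def)
  moreover have "{x \<in> free_mod V (rk P 0). aug_map P x \<in> {0}} = diff_map P 0 ` free_mod V (rk P 1)"
    unfolding rk free_mod_0 aug diff
    by (auto simp: free_mod_def fun_eq_iff poly_ring_closed) (metis One_nat_def Suc_leI neq0_conv)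
  moreover have "{x \<in> free_mod V (rk P (Suc i)). diff_map P i x = 0}
      = diff_map P (Suc i) ` free_mod V (rk P (Suc (Suc i)))" for i
    unfolding rk free_mod_0 diff by auto
  moreover have "k < rk P 0 \<Longrightarrow> aug P k \<in> poly_ring V \<and> (\<forall>m\<in>Poly_Mapping.keys (aug P k). mono_deg m = sh P 0 k)" for k
    by (simp add: P_def poly_ring_def mono_deg_def)
  ultimately have "graded_free_resolution V {0} P"
    unfolding graded_free_resolution_def by (simp add: rk)
  then show ?case unfolding zero by blast
next
  case (insert w W)
  then obtain P where P: "graded_free_resolution V
      (supp_ideal V (\<lambda>X. X \<inter> W \<noteq> {}) :: ('v, 'k) mpoly set) P" by auto
  let ?f = "Poly_Mapping.single (sqfree {w}) 1 :: ('v, 'k) mpoly"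
  let ?A = "supp_ideal V (\<lambda>X. X \<inter> W \<noteq> {}) :: ('v, 'k) mpoly set"
  have w: "w \<in> V" using insert.prems by simp
  have f: "?f \<in> pspan {m. Poly_Mapping.keys m \<subseteq> V \<and> mono_deg m = 1}"
    using w by (simp add: pspan_def keys_sqfree mono_deg_sqfree)
  have colon: "(\<lambda>X. ({w} \<union> X) \<inter> W \<noteq> {}) = (\<lambda>X. X \<inter> W \<noteq> {})" using insert.hyps by auto
  have "graded_free_resolution V (supp_ideal V (\<lambda>X. X \<inter> insert w W \<noteq> {})) (cone ?f P)"
  proof (rule cone_resolution[OF P f _ _ _ _ _ supp_ideal_meets_insert[OF w]])
    show "p + q \<in> ?A" if "p \<in> ?A" "q \<in> ?A" for p q
      using that unfolding supp_ideal_def by (rule pspan_add)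
    show "- p \<in> ?A" if "p \<in> ?A" for p
      using that unfolding supp_ideal_def by (rule pspan_uminus)
    show "0 \<in> ?A" by (simp add: supp_ideal_def)
    show "?f * p \<in> ?A" if "p \<in> ?A" for p
      using supp_ideal_colon_mult[of p V "\<lambda>X. X \<inter> W \<noteq> {}" "{w}"] that w unfolding colon by simp
    show "s \<in> ?A" if "?f * s \<in> ?A" for s
      using supp_ideal_colon[OF that] unfolding colon by simp
  qed
  then show ?case by blast
qed

section \<open>Removing a facet\<close>

text \<open>The scalar action is written exactly as in \<open>vec_dim\<close>, so the dimension
  lemmas apply to Betti numbers.\<close>

interpretation vec: vector_space "\<lambda>(c::'k::field) (x :: nat \<Rightarrow> ('v, 'k) mpoly) k. const c * x k"
  by unfold_locales
    (auto simp: fun_eq_iff const_def distrib_left distrib_right single_add mult_single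
      mult.assoc[symmetric] single_one)

lemma sum_apply: "(\<Sum>a\<in>S. f a) k = (\<Sum>a\<in>S. f a k :: 'a::comm_monoid_add)"
  by (induction S rule: infinite_finite_induct) simp_all

lemma supp_ideal_const_mult: "p \<in> supp_ideal V N \<Longrightarrow> const c * p \<in> supp_ideal V N"
  unfolding supp_ideal_def
  by (rule pspan_mult[of _ "{0}"]) (auto simp: pspan_def const_def)

lemma graded_shift_const_mult:
  assumes "x \<in> graded_shift V P i t e"
  shows "(\<lambda>k. const c * x k) \<in> graded_shift V P i t e"
proof -
  have "const c * x k \<in> pspan M" if "x k \<in> pspan M" for k M
    by (rule pspan_mult[OF _ that, of _ "{0}"]) (auto simp: pspan_def const_def)
  then show ?thesis using assms by (simp add: graded_shift_def)
qed

lemma cycles_mod_subspace: "vec.subspace (cycles_mod V P (supp_ideal V N) i t e)"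
proof (rule vec.subspaceI)
  show "0 \<in> cycles_mod V P (supp_ideal V N) i t e"
    using graded_shift_zero[of V P i t e]
    by (simp add: cycles_mod_def supp_ideal_def zero_fun_def)
next
  fix x y assume "x \<in> cycles_mod V P (supp_ideal V N) i t e" "y \<in> cycles_mod V P (supp_ideal V N) i t e"
  then show "x + y \<in> cycles_mod V P (supp_ideal V N) i t e"
    unfolding plus_fun_def cycles_mod_def supp_ideal_def
    by (auto simp: diff_map_add intro: graded_shift_add pspan_add)
next
  fix c x assume "x \<in> cycles_mod V P (supp_ideal V N) i t e"
  then show "(\<lambda>k. const c * x k) \<in> cycles_mod V P (supp_ideal V N) i t e"
    unfolding cycles_mod_def
    by (auto simp: diff_map_mult intro: graded_shift_const_mult supp_ideal_const_mult)
qed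

lemma boundaries_mod_subspace: "vec.subspace (boundaries_mod V P (supp_ideal V N) i t e)"
proof (rule vec.subspaceI)
  show "0 \<in> boundaries_mod V P (supp_ideal V N) i t e"
    unfolding boundaries_mod_def zero_fun_def
    by (intro CollectI conjI bexI[OF _ graded_shift_zero] graded_shift_zero) (simp add: supp_ideal_def)
next
  fix x y assume "x \<in> boundaries_mod V P (supp_ideal V N) i t e"
    and "y \<in> boundaries_mod V P (supp_ideal V N) i t e"
  then obtain u v where xy: "x \<in> graded_shift V P i t e" "y \<in> graded_shift V P i t e"
    and u: "u \<in> graded_shift V P (Suc i) t e" "\<And>k. x k - diff_map P i u k \<in> supp_ideal V N"
    and v: "v \<in> graded_shift V P (Suc i) t e" "\<And>k. y k - diff_map P i v k \<in> supp_ideal V N"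
    unfolding boundaries_mod_def by blast
  have "x k + y k - diff_map P i (\<lambda>k. u k + v k) k \<in> supp_ideal V N" for k
    using pspan_add[OF u(2)[of k, unfolded supp_ideal_def] v(2)[of k, unfolded supp_ideal_def]]
    by (simp add: supp_ideal_def diff_map_add algebra_simps)
  then show "x + y \<in> boundaries_mod V P (supp_ideal V N) i t e"
    unfolding boundaries_mod_def plus_fun_def
    using graded_shift_add[OF xy] graded_shift_add[OF u(1) v(1)] by blast
next
  fix c x assume "x \<in> boundaries_mod V P (supp_ideal V N) i t e"
  then obtain u where x: "x \<in> graded_shift V P i t e"
    and u: "u \<in> graded_shift V P (Suc i) t e" "\<And>k. x k - diff_map P i u k \<in> supp_ideal V N"
    unfolding boundaries_mod_def by blast
  have "const c * x k - diff_map P i (\<lambda>k. const c * u k) k \<in> supp_ideal V N" for k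
    using supp_ideal_const_mult[OF u(2)[of k], of c] by (simp add: diff_map_mult right_diff_distrib)
  then show "(\<lambda>k. const c * x k) \<in> boundaries_mod V P (supp_ideal V N) i t e"
    unfolding boundaries_mod_def
    using graded_shift_const_mult[OF x] graded_shift_const_mult[OF u(1)] by blast
qed

text \<open>Supplies the finite set \<open>E\<close> for the dimension comparisons: finitely many
  variables have finitely many monomials of bounded degree.\<close>

lemma graded_shift_finite_span:
  fixes P :: "('v, 'k::field) free_cplx"
  assumes "finite V"
  obtains E where "finite E" "graded_shift V P i t e \<subseteq> vec.span E"
proof -
  define b where "b k m = (\<lambda>l. if l = k then Poly_Mapping.single m (1::'k) else 0)"
    for k :: nat and m :: "'v \<Rightarrow>\<^sub>0 nat"
  \<comment> \<open>The shifts only lower the degree, so the bound \<open>e\<close> serves all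
    coordinates; the surplus monomials do no harm to a spanning set.\<close>
  let ?M = "{m. Poly_Mapping.keys m \<subseteq> V \<and> mono_deg m \<le> e}"
  let ?E = "(\<lambda>(k, m). b k m) ` ({..<rk P i} \<times> ?M)"
  have "finite ?E" using finite_monomials[OF assms] by simp
  moreover have "x \<in> vec.span ?E" if x: "x \<in> graded_shift V P i t e" for x
  proof -
    let ?s = "\<Sum>k<rk P i. \<Sum>m\<in>Poly_Mapping.keys (x k). (\<lambda>l. const (Poly_Mapping.lookup (x k) m) * b k m l)"
    have "x l = ?s l" for l
    proof (cases "l < rk P i")
      case True
      have "?s l = (\<Sum>k<rk P i. if l = k
          then \<Sum>m\<in>Poly_Mapping.keys (x k). Poly_Mapping.single m (Poly_Mapping.lookup (x k) m) else 0)"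
        unfolding sum_apply by (intro sum.cong) (auto simp: b_def const_def mult_single)
      also have "\<dots> = x l"
        using True poly_eq_sum_monomials[of "x l", symmetric] by simp
      finally show ?thesis by simp
    next
      case False
      then have "x l = 0" using x by (simp add: graded_shift_def)
      moreover have "?s l = 0"
        unfolding sum_apply using False by (intro sum.neutral ballI) (simp add: b_def)
      ultimately show ?thesis by simp
    qed
    then have "x = ?s" by blast
    moreover have "?s \<in> vec.span ?E"
    proof (intro vec.span_sum vec.span_scale vec.span_base)
      fix k m assume k: "k \<in> {..<rk P i}" and "m \<in> Poly_Mapping.keys (x k)"
      moreover have "x k \<in> pspan {m. Poly_Mapping.keys m \<subseteq> V \<and> mono_deg m + sh P i k + t = e}"
        using x k by (simp add: graded_shift_def)
      ultimately have "m \<in> ?M" by (auto simp: pspan_def)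
      then show "b k m \<in> ?E" using k by (intro image_eqI[of _ _ "(k, m)"]) auto
    qed
    ultimately show ?thesis by argo
  qed
  ultimately show ?thesis using that by blast
qed

lemma cycles_mod_mono: "I \<subseteq> J \<Longrightarrow> cycles_mod V P I i t e \<subseteq> cycles_mod V P J i t e"
  unfolding cycles_mod_def by blast

lemma boundaries_mod_mono: "I \<subseteq> J \<Longrightarrow> boundaries_mod V P I i t e \<subseteq> boundaries_mod V P J i t e"
  unfolding boundaries_mod_def by blast

section \<open>Facet deletion and nested complexes\<close>

lemma simplicial_complexD:
  assumes "simplicial_complex V \<Gamma>"
  shows "finite V" "finite \<Gamma>" "{} \<in> \<Gamma>"
    and "F \<in> \<Gamma> \<Longrightarrow> F \<subseteq> V" "F \<in> \<Gamma> \<Longrightarrow> finite F" "F \<in> \<Gamma> \<Longrightarrow> G \<subseteq> F \<Longrightarrow> G \<in> \<Gamma>"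
  using assms finite_subset[of \<Gamma> "Pow V"] finite_subset[of F V]
  unfolding simplicial_complex_def by auto

lemma non_face_mono: "simplicial_complex V \<Gamma> \<Longrightarrow> mono (\<lambda>X. X \<notin> \<Gamma>)"
  unfolding simplicial_complex_def by (intro monoI) (auto simp: le_bool_def)

text \<open>Injectivity needs the shifted Tor term in homological degree \<open>i\<close> to vanish
  at internal degree \<open>i + j\<close>, which fails only for \<open>card F = j\<close>;
  surjectivity needs this in degree \<open>i - 1\<close>, where the critical size is
  \<open>card F = j + 1\<close>.\<close>

lemma betti_remove_facet:
  fixes V :: "'v set"
  assumes \<Gamma>: "simplicial_complex V \<Gamma>" and \<Gamma>': "simplicial_complex V (\<Gamma> - {F})"
    and F: "F \<in> \<Gamma>" "\<And>G. G \<in> \<Gamma> \<Longrightarrow> F \<subseteq> G \<Longrightarrow> G = F"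
  shows "j < card F \<Longrightarrow> betti TYPE('k::field) V \<Gamma> i (i + j) \<le> betti TYPE('k) V (\<Gamma> - {F}) i (i + j)"
    and "card F \<le> j \<Longrightarrow> betti TYPE('k) V (\<Gamma> - {F}) i (i + j) \<le> betti TYPE('k) V \<Gamma> i (i + j)"
proof -
  have V: "finite V" and FV: "F \<subseteq> V" and finF: "finite F"
    using simplicial_complexD[OF \<Gamma>] F(1) by simp_all
  \<comment> \<open>The irrelevant ideal depends on \<open>V\<close> alone, so both Betti numbers
    use the same chosen resolution and can be compared inside it.\<close>
  define P :: "('v, 'k) free_cplx" where "P = (SOME P. graded_free_resolution V (irrelevant_ideal V) P)"
  have "\<exists>P :: ('v, 'k) free_cplx. graded_free_resolution V (irrelevant_ideal V) P"
    unfolding irrelevant_ideal_eq[OF V] by (rule resolution_exists[OF V order_refl])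
  then have res: "graded_free_resolution V (irrelevant_ideal V) P"
    unfolding P_def by (rule someI_ex)
  interpret graded_free_complex V P by (rule graded_free_complex_of_resolution[OF V res])
  let ?f = "Poly_Mapping.single (sqfree F) 1 :: ('v, 'k) mpoly"
  let ?N = "\<lambda>X. X \<notin> \<Gamma>"
  define I where "I = (supp_ideal V ?N :: ('v, 'k) mpoly set)"
  define J where "J = (supp_ideal V (\<lambda>X. X \<notin> \<Gamma> - {F}) :: ('v, 'k) mpoly set)"
  \<comment> \<open>Deleting the facet adds just \<open>x\<^sub>F\<close> to the ideal, because no
    other face contains \<open>F\<close>.\<close>
  have J: "J = supp_ideal V (\<lambda>X. ?N X \<or> F \<subseteq> X)"
    unfolding J_def
  proof (rule supp_ideal_cong)
    fix X
    show "X \<notin> \<Gamma> - {F} \<longleftrightarrow> X \<notin> \<Gamma> \<or> F \<subseteq> X" using F(1) F(2)[of X] by blast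
  qed
  have IJ: "I \<subseteq> J"
    unfolding I_def J supp_ideal_def by (auto simp: pspan_def)
  \<comment> \<open>For a facet, \<open>F \<union> X\<close> is a face only if
    \<open>X \<subseteq> F\<close>; the colon ideal is thus generated by the variables outside
    \<open>F\<close>.\<close>
  have A: "supp_ideal V (\<lambda>X. ?N (F \<union> X)) = (supp_ideal V (\<lambda>X. X \<inter> (V - F) \<noteq> {}) :: ('v, 'k) mpoly set)"
  proof (rule supp_ideal_cong)
    fix X assume "X \<subseteq> V"
    then have "F \<union> X = F \<longleftrightarrow> X \<inter> (V - F) = {}" by blast
    moreover have "F \<union> X \<in> \<Gamma> \<longleftrightarrow> F \<union> X = F"
      using F(1) F(2)[of "F \<union> X"] Un_upper1[of F X] by metis
    ultimately show "F \<union> X \<notin> \<Gamma> \<longleftrightarrow> X \<inter> (V - F) \<noteq> {}" by simp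
  qed
  have mono: "mono ?N" "mono (\<lambda>X. X \<notin> \<Gamma> - {F})"
    using non_face_mono[OF \<Gamma>] non_face_mono[OF \<Gamma>'] by simp_all
  let ?e = "i + j"
  let ?Z = "\<lambda>I. cycles_mod V P I i 0 ?e" and ?B = "\<lambda>I. boundaries_mod V P I i 0 ?e"
  have zero: "0 \<in> I" "0 \<in> J" by (simp_all add: I_def J_def supp_ideal_def)
  have betti: "betti TYPE('k) V \<Gamma> i ?e = vec_dim (?Z I) - vec_dim (?B I)"
      "betti TYPE('k) V (\<Gamma> - {F}) i ?e = vec_dim (?Z J) - vec_dim (?B J)"
    unfolding betti_def tor_dim_def Let_def P_def[symmetric]
      sr_ideal_eq_pspan[OF \<Gamma>] sr_ideal_eq_pspan[OF \<Gamma>'] I_def[symmetric] J_def[symmetric]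
    by (simp_all add: tor_cycles_eq tor_boundaries_eq zero)
  obtain E where E: "finite E" "graded_shift V P i 0 ?e \<subseteq> vec.span E"
    using graded_shift_finite_span[OF V] by blast
  have span: "?Z K \<subseteq> vec.span E" for K
    using E(2) unfolding cycles_mod_def by blast
  have sub: "vec.subspace (?Z I)" "vec.subspace (?B I)" "vec.subspace (?Z J)" "vec.subspace (?B J)"
    unfolding I_def J_def by (rule cycles_mod_subspace boundaries_mod_subspace)+
  have BZ: "?B I \<subseteq> ?Z I" "?B J \<subseteq> ?Z J"
    unfolding I_def J_def using mono by (simp_all add: boundaries_subset_cycles)
  have vanish: "cycles_mod V P (supp_ideal V (\<lambda>X. ?N (F \<union> X))) i' (0 + card F) ?e
      \<subseteq> boundaries_mod V P (supp_ideal V (\<lambda>X. ?N (F \<union> X))) i' (0 + card F) ?e"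
    if "?e \<noteq> i' + card F" for i'
    unfolding A by (rule tor_linear_vanishing[OF V res]) (use that in auto)
  show "betti TYPE('k) V \<Gamma> i ?e \<le> betti TYPE('k) V (\<Gamma> - {F}) i ?e" if j: "j < card F"
    unfolding betti
  proof (rule vec.dim_quotient_le_inj[OF sub(2,1,4,3) BZ cycles_mod_mono[OF IJ] span E(1)])
    show "?Z I \<inter> ?B J \<subseteq> ?B I"
    proof
      fix x assume "x \<in> ?Z I \<inter> ?B J"
      moreover have "?e \<noteq> i + card F" using j by simp
      ultimately show "x \<in> ?B I"
        unfolding I_def J using boundary_lift[OF mono(1) finF FV vanish] by simp
    qed
  qed
  show "betti TYPE('k) V (\<Gamma> - {F}) i ?e \<le> betti TYPE('k) V \<Gamma> i ?e" if j: "card F \<le> j"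
    unfolding betti
  proof (rule vec.dim_quotient_le_surj[OF sub(2,1,4,3) BZ boundaries_mod_mono[OF IJ] span span E(1)])
    fix x assume x: "x \<in> ?Z J"
    have van: "cycles_mod V P (supp_ideal V (\<lambda>X. ?N (F \<union> X))) i' (0 + card F) ?e
        \<subseteq> boundaries_mod V P (supp_ideal V (\<lambda>X. ?N (F \<union> X))) i' (0 + card F) ?e"
      if "i = Suc i'" for i'
      by (rule vanish) (use that j in auto)
    obtain y where y: "y \<in> graded_shift V P i (0 + card F) ?e"
        "(\<lambda>k. x k - ?f * y k) \<in> cycles_mod V P (supp_ideal V ?N) i 0 ?e"
      by (rule cycle_lift[OF mono(1) finF FV van x[unfolded J]]) blast+
    \<comment> \<open>The correction from \<open>cycle_lift\<close> vanishes modulo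
      \<open>J\<close>, so it is a boundary with primitive 0.\<close>
    have "?f * y k \<in> J" for k
    proof -
      have "y k \<in> poly_ring V"
        using graded_shift_free_mod[OF y(1)]
        by (cases "k < rk P i") (auto simp: free_mod_def poly_ring_closed)
      moreover have "?f \<in> J" using FV by (simp add: J supp_ideal_def pspan_def keys_sqfree finF)
      ultimately show ?thesis unfolding J_def by (intro supp_ideal_mult mono)
    qed
    then have "(\<lambda>k. ?f * y k) \<in> ?B J"
      unfolding boundaries_mod_def
      using graded_shift_monomial_mult[OF y(1) finF FV] graded_shift_zero[of V P "Suc i" 0 ?e]
      by (auto intro!: bexI[of _ "\<lambda>k. 0"])
    moreover have "x - (\<lambda>k. x k - ?f * y k) = (\<lambda>k. ?f * y k)"
      by (simp add: fun_eq_iff)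
    ultimately show "\<exists>z\<in>?Z I. x - z \<in> ?B J"
      using y(2) unfolding I_def by (intro bexI[of _ "\<lambda>k. x k - ?f * y k"]) simp_all
  qed
qed

text \<open>Faces outside \<open>\<Gamma>1\<close> are deleted from \<open>\<Gamma>2\<close> one by
  one, largest first, so that each is a facet when its turn comes.\<close>

lemma betti_subcomplex:
  fixes V :: "'v set"
  assumes "simplicial_complex V \<Gamma>1" "simplicial_complex V \<Gamma>2" "\<Gamma>1 \<subseteq> \<Gamma>2"
  shows "(\<And>F. F \<in> \<Gamma>2 - \<Gamma>1 \<Longrightarrow> j < card F)
      \<Longrightarrow> betti TYPE('k::field) V \<Gamma>2 i (i + j) \<le> betti TYPE('k) V \<Gamma>1 i (i + j)"
    and "(\<And>F. F \<in> \<Gamma>2 - \<Gamma>1 \<Longrightarrow> card F \<le> j)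
      \<Longrightarrow> betti TYPE('k) V \<Gamma>1 i (i + j) \<le> betti TYPE('k) V \<Gamma>2 i (i + j)"
proof -
  have "((\<forall>F\<in>\<Gamma>2 - \<Gamma>1. j < card F) \<longrightarrow> betti TYPE('k::field) V \<Gamma>2 i (i + j) \<le> betti TYPE('k) V \<Gamma>1 i (i + j))
    \<and> ((\<forall>F\<in>\<Gamma>2 - \<Gamma>1. card F \<le> j) \<longrightarrow> betti TYPE('k) V \<Gamma>1 i (i + j) \<le> betti TYPE('k) V \<Gamma>2 i (i + j))"
    (is "?Q \<Gamma>2")
    using assms(2,3)
  proof (induction "card (\<Gamma>2 - \<Gamma>1)" arbitrary: \<Gamma>2)
    case 0
    have "finite \<Gamma>2" by (rule simplicial_complexD[OF 0(2)])
    then have "\<Gamma>2 = \<Gamma>1" using 0(1,3) by auto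
    then show ?case by simp
  next
    case (Suc n)
    note complex = simplicial_complexD[OF Suc(3)]
    note fin = complex(2)
    obtain F where F: "F \<in> \<Gamma>2 - \<Gamma>1" "\<And>G. G \<in> \<Gamma>2 - \<Gamma>1 \<Longrightarrow> card G \<le> card F"
    proof -
      have "\<Gamma>2 - \<Gamma>1 \<noteq> {}" using Suc(2) by force
      then have "Max (card ` (\<Gamma>2 - \<Gamma>1)) \<in> card ` (\<Gamma>2 - \<Gamma>1)"
        using fin by (intro Max_in) simp_all
      then obtain F where "F \<in> \<Gamma>2 - \<Gamma>1" "Max (card ` (\<Gamma>2 - \<Gamma>1)) = card F" by (rule imageE)
      moreover have "card G \<le> Max (card ` (\<Gamma>2 - \<Gamma>1))" if "G \<in> \<Gamma>2 - \<Gamma>1" for G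
        using that fin by (intro Max_ge) simp_all
      ultimately show ?thesis using that[of F] by simp
    qed
    \<comment> \<open>A face containing \<open>F\<close> cannot lie in the subcomplex
      \<open>\<Gamma>1\<close>, so the maximal cardinality of \<open>F\<close> applies to
      it.\<close>
    have facet: "G = F" if G: "G \<in> \<Gamma>2" "F \<subseteq> G" for G
    proof -
      have "G \<notin> \<Gamma>1" using F(1) simplicial_complexD(6)[OF assms(1) _ G(2)] by auto
      then have "card G \<le> card F" using F(2) G(1) by simp
      then show ?thesis using card_seteq[OF complex(5)[OF G(1)] G(2)] by simp
    qed
    have sub: "simplicial_complex V (\<Gamma>2 - {F})"
      unfolding simplicial_complex_def
    proof (intro conjI ballI allI impI)
      show "finite V" by (rule complex(1))
      show "\<Gamma>2 - {F} \<subseteq> Pow V" using complex(4) by auto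
      show "{} \<in> \<Gamma>2 - {F}" using simplicial_complexD(3)[OF assms(1)] complex(3) F(1) by auto
      fix X Y assume X: "X \<in> \<Gamma>2 - {F}" and Y: "Y \<subseteq> X"
      have "Y \<noteq> F" using facet[of X] X Y by auto
      then show "Y \<in> \<Gamma>2 - {F}" using complex(6)[OF _ Y] X by simp
    qed
    have "\<Gamma>2 - {F} - \<Gamma>1 = (\<Gamma>2 - \<Gamma>1) - {F}" by blast
    then have "n = card (\<Gamma>2 - {F} - \<Gamma>1)" using Suc(2) F(1) fin by simp
    moreover have "\<Gamma>1 \<subseteq> \<Gamma>2 - {F}" using Suc(4) F(1) by blast
    ultimately have IH: "?Q (\<Gamma>2 - {F})" using Suc(1) sub by simp
    have "F \<in> \<Gamma>2" using F(1) by blast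
    note step = betti_remove_facet[OF Suc(3) sub this facet, where 'k = 'k and i = i and j = j]
    show ?case
    proof (intro conjI impI)
      assume "\<forall>F\<in>\<Gamma>2 - \<Gamma>1. j < card F"
      then have "j < card F" "\<forall>F'\<in>\<Gamma>2 - {F} - \<Gamma>1. j < card F'" using F(1) by blast+
      then show "betti TYPE('k) V \<Gamma>2 i (i + j) \<le> betti TYPE('k) V \<Gamma>1 i (i + j)"
        using step(1) IH by linarith
    next
      assume "\<forall>F\<in>\<Gamma>2 - \<Gamma>1. card F \<le> j"
      then have "card F \<le> j" "\<forall>F'\<in>\<Gamma>2 - {F} - \<Gamma>1. card F' \<le> j" using F(1) by blast+
      then show "betti TYPE('k) V \<Gamma>1 i (i + j) \<le> betti TYPE('k) V \<Gamma>2 i (i + j)"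
        using step(2) IH by linarith
    qed
  qed
  note Q = this
  show "betti TYPE('k) V \<Gamma>2 i (i + j) \<le> betti TYPE('k) V \<Gamma>1 i (i + j)"
    if "\<And>F. F \<in> \<Gamma>2 - \<Gamma>1 \<Longrightarrow> j < card F"
    by (rule Q[THEN conjunct1, THEN mp], rule ballI, rule that)
  show "betti TYPE('k) V \<Gamma>1 i (i + j) \<le> betti TYPE('k) V \<Gamma>2 i (i + j)"
    if "\<And>F. F \<in> \<Gamma>2 - \<Gamma>1 \<Longrightarrow> card F \<le> j"
    by (rule Q[THEN conjunct2, THEN mp], rule ballI, rule that)
qed

lemma simplicial_complex_skel:
  assumes "simplicial_complex V \<Gamma>"
  shows "simplicial_complex V (skel (int j - 1) \<Gamma>)"
  unfolding simplicial_complex_def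
proof (intro conjI ballI allI impI)
  note complex = simplicial_complexD[OF assms]
  show "finite V" by (rule complex(1))
  show "skel (int j - 1) \<Gamma> \<subseteq> Pow V" using complex(4) by (auto simp: skel_def)
  show "{} \<in> skel (int j - 1) \<Gamma>" using complex(3) by (simp add: skel_def face_dim_def)
  fix F G assume F: "F \<in> skel (int j - 1) \<Gamma>" and G: "G \<subseteq> F"
  have "card G \<le> card F" using complex(5) F G by (intro card_mono) (simp_all add: skel_def)
  then show "G \<in> skel (int j - 1) \<Gamma>"
    using complex(6)[OF _ G] F by (simp add: skel_def face_dim_def)
qed

lemma simplicial_complex_clique_complex:
  assumes "finite V"
  shows "simplicial_complex V (clique_complex V E)"
  unfolding simplicial_complex_def
proof (intro conjI ballI allI impI)
  fix F G assume F: "F \<in> clique_complex V E" and G: "G \<subseteq> F"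
  show "G \<in> clique_complex V E"
    unfolding clique_complex_def
  proof (intro CollectI conjI ballI impI)
    show "G \<subseteq> V" using F G by (auto simp: clique_complex_def)
    fix u v assume "u \<in> G" "v \<in> G" "u \<noteq> v"
    then show "{u, v} \<in> E" using F subsetD[OF G] by (simp add: clique_complex_def)
  qed
qed (use assms in \<open>auto simp: clique_complex_def\<close>)

text \<open>Two distinct vertices of a face have different colors, hence are joined in the complete
  multipartite graph.\<close>

lemma balanced_subset_clique_complex:
  assumes "balanced_complex d V C \<Delta>"
  shows "\<Delta> \<subseteq> clique_complex V (complete_multipartite_edges d C)"
proof
  fix F assume F: "F \<in> \<Delta>"
  then have FV: "F \<subseteq> V" and finF: "finite F"
    using assms simplicial_complexD(4,5) unfolding balanced_complex_def by auto
  have "{u, v} \<in> complete_multipartite_edges d C" if uv: "u \<in> F" "v \<in> F" "u \<noteq> v" for u v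
  proof -
    obtain a b where ab: "a \<in> {1..d}" "u \<in> C a" "b \<in> {1..d}" "v \<in> C b"
      using uv FV assms unfolding balanced_complex_def color_partition_def by blast
    have "a \<noteq> b"
    proof
      assume "a = b"
      then have "{u, v} \<subseteq> F \<inter> C a" using uv ab by blast
      then have "card {u, v} \<le> card (F \<inter> C a)" using finF by (intro card_mono) auto
      moreover have "card (F \<inter> C a) \<le> 1" using assms F ab(1) unfolding balanced_complex_def by blast
      ultimately show False using uv(3) by simp
    qed
    then show ?thesis unfolding complete_multipartite_edges_def using ab by blast
  qed
  then show "F \<in> clique_complex V (complete_multipartite_edges d C)"
    unfolding clique_complex_def using FV by blast
qed

theorem theorem3p1:
  fixes V :: "'v set" and C :: "nat \<Rightarrow> 'v set" and \<Delta> :: "'v set set" and d i j :: nat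
  assumes "balanced_complex d V C \<Delta>"
  shows "betti TYPE('k::field) V \<Delta> i (i + j)
    \<le> betti TYPE('k) V
         (skel (int j - 1) (clique_complex V (complete_multipartite_edges d C))) i (i + j)"
proof -
  let ?K = "clique_complex V (complete_multipartite_edges d C)"
  have \<Delta>: "simplicial_complex V \<Delta>" and "finite V"
    using assms by (auto simp: balanced_complex_def simplicial_complex_def)
  then have K: "simplicial_complex V ?K" by (intro simplicial_complex_clique_complex)
  \<comment> \<open>Passing to the skeleton deletes only faces of dimension at least
    \<open>j\<close>, that is, with more than \<open>j\<close> vertices.\<close>
  have "betti TYPE('k) V \<Delta> i (i + j) \<le> betti TYPE('k) V (skel (int j - 1) \<Delta>) i (i + j)"
    by (rule betti_subcomplex(1)[OF simplicial_complex_skel[OF \<Delta>] \<Delta>])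
      (auto simp: skel_def face_dim_def)
  \<comment> \<open>Every face added here has dimension at most \<open>j - 1\<close>, that is, at
    most \<open>j\<close> vertices.\<close>
  also have "\<dots> \<le> betti TYPE('k) V (skel (int j - 1) ?K) i (i + j)"
    by (rule betti_subcomplex(2)[OF simplicial_complex_skel[OF \<Delta>] simplicial_complex_skel[OF K]])
      (use balanced_subset_clique_complex[OF assms] in \<open>auto simp: skel_def face_dim_def\<close>)
  finally show ?thesis .
qed

end
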